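(* Let $N\subseteq M$ be von Neumann algebras and let $E:M\to N$ be a faithful normal conditional expectation. Then the space $\mathcal X(E)=\mathcal U_M/\mathcal H_E$ is a covering space for the unitary orbit $\mathcal U(E)$, with covering map $\Phi:\mathcal X(E)\to\mathcal U(E)$, $\Phi(u\mathcal H_E)=L_u(E)$ ($u\in\mathcal U_M$), and group of covering transformations $W(E)$.
   Context: $\mathcal U_A$ denotes the unitary group of a von Neumann algebra $A$, with the norm topology. For $u\in\mathcal U_M$, $L_u(E)=uE(u^{*}\cdot u)u^{*}$, i.e. $L_u(E)(x)=uE(u^*xu)u^*$. The unitary orbit of $E$ is $\mathcal U(E)=\{L_u(E):u\in\mathcal U_M\}$, with the quotient topology induced by the norm topology of $\mathcal U_M$ through $u\mapsto L_u(E)$. The normalizer of $E$ is $\mathcal N_E=\{u\in\mathcal U_M: E(uxu^* )=uE(x)u^*\ \forall x\in M\}$, so $\mathcal U(E)\simeq\mathcal U_M/\mathcal N_E$. The centralizer of $E$ is $M_E=\{x\in N'\cap M: E(xm)=E(mx)\ \forall m\in M\}$. $\mathcal H_E=\mathcal U_N\cdot\mathcal U_{M_E}=\{vw:v\in\mathcal U_N,\ w\in\mathcal U_{M_E}\}$; it is known to be the connected component of $1$ in $\mathcal N_E$ and an open, closed, normal subgroup of $\mathcal N_E$. The Weyl group of $E$ is the discrete group $W(E)=\pi_0(\mathcal N_E)\simeq\mathcal N_E/\mathcal H_E$. The space $\mathcal X(E)=\mathcal U_M/\mathcal H_E$ carries the quotient topology of the norm topology of $\mathcal U_M$, and $W(E)$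 acts on it by right multiplication, $(u\mathcal H_E)\cdot(w\mathcal H_E)=uw\mathcal H_E$ for $u\in\mathcal U_M$, $w\in\mathcal N_E$. *)

theory Defs
  imports "HOL-Analysis.Analysis" "HOL-Algebra.Coset" "HOL-Algebra.Bij"
begin

section \<open>Complex Hilbert spaces and bounded operators\<close>

text \<open>The inner product is linear in the first argument.  Positive definiteness
  need not be assumed separately: it follows from \<open>norm_eq_sqrt_cinner\<close> and the norm axioms.\<close>

class complex_hilbert_space = banach +
  fixes scaleC :: "complex \<Rightarrow> 'a \<Rightarrow> 'a" (infixr "*\<^sub>C" 75)
    and cinner :: "'a \<Rightarrow> 'a \<Rightarrow> complex"
  assumes scaleC_add_right: "c *\<^sub>C (x + y) = c *\<^sub>C x + c *\<^sub>C y"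
    and scaleC_add_left: "(c + d) *\<^sub>C x = c *\<^sub>C x + d *\<^sub>C x"
    and scaleC_scaleC: "c *\<^sub>C d *\<^sub>C x = (c * d) *\<^sub>C x"
    and scaleC_of_real: "complex_of_real r *\<^sub>C x = r *\<^sub>R x"
    and cinner_add_left: "cinner (x + y) z = cinner x z + cinner y z"
    and cinner_scaleC_left: "cinner (c *\<^sub>C x) y = c * cinner x y"
    and cinner_commute: "cinner x y = cnj (cinner y x)"
    and norm_eq_sqrt_cinner: "norm x = sqrt (Re (cinner x x))"

instantiation complex :: complex_hilbert_space
begin
definition "scaleC_complex (c::complex) (x::complex) = c * x"
definition "cinner_complex (x::complex) (y::complex) = x * cnj y"
instance
  by standard
    (auto simp: scaleC_complex_def cinner_complex_def algebra_simps scaleR_conv_of_real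
      cmod_def power2_eq_square)
end

lemma norm_scaleC: "norm (c *\<^sub>C x) = cmod c * norm (x :: 'a::complex_hilbert_space)"
proof -
  have "cinner (c *\<^sub>C x) (c *\<^sub>C x) = c * cnj c * cinner x x"
    by (metis cinner_commute cinner_scaleC_left complex_cnj_mult mult.assoc)
  also have "c * cnj c = complex_of_real ((cmod c)\<^sup>2)"
    by (rule complex_norm_square [symmetric])
  finally have "Re (cinner (c *\<^sub>C x) (c *\<^sub>C x)) = (cmod c)\<^sup>2 * Re (cinner x x)"
    by simp
  then show ?thesis
    by (simp add: norm_eq_sqrt_cinner [where x = "c *\<^sub>C x"] norm_eq_sqrt_cinner [of x] real_sqrt_mult)
qed

lemma bounded_linear_scaleC: "bounded_linear ((*\<^sub>C) c :: 'a \<Rightarrow> 'a::complex_hilbert_space)"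
proof (rule bounded_linear_intro)
  show "c *\<^sub>C (r *\<^sub>R x) = r *\<^sub>R (c *\<^sub>C x)" for r and x :: 'a
    by (metis scaleC_of_real scaleC_scaleC mult.commute)
  show "norm (c *\<^sub>C x) \<le> norm x * cmod c" for x :: 'a
    by (simp add: norm_scaleC mult.commute)
qed (rule scaleC_add_right)

text \<open>The type \<open>'h \<Rightarrow>\<^sub>L 'h\<close> consists of the real-linear bounded operators; its norm is the
  operator norm.  \<open>B(H)\<close> is the set of complex-linear ones.\<close>

type_synonym 'h oper = "'h \<Rightarrow>\<^sub>L 'h"

definition bounded_ops :: "'h::complex_hilbert_space oper set" where
  "bounded_ops = {T. \<forall>c x. blinfun_apply T (c *\<^sub>C x) = c *\<^sub>C blinfun_apply T x}"

definition hadj :: "'h::complex_hilbert_space oper \<Rightarrow> 'h oper" where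
  "hadj T = (THE S. \<forall>x y. cinner (blinfun_apply T x) y = cinner x (blinfun_apply S y))"

definition scalar_op :: "complex \<Rightarrow> 'h::complex_hilbert_space oper" where
  "scalar_op c = Blinfun ((*\<^sub>C) c)"

lemma scalar_op_apply: "blinfun_apply (scalar_op c) x = c *\<^sub>C x"
  by (simp add: scalar_op_def bounded_linear_Blinfun_apply bounded_linear_scaleC)

definition positive_op :: "'h::complex_hilbert_space oper \<Rightarrow> bool" where
  "positive_op T \<longleftrightarrow> T \<in> bounded_ops \<and> (\<forall>x. cinner (blinfun_apply T x) x \<in> \<real>\<^sub>\<ge>\<^sub>0)"

definition op_le :: "'h::complex_hilbert_space oper \<Rightarrow> 'h oper \<Rightarrow> bool" where
  "op_le S T \<longleftrightarrow> positive_op (T - S)"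

definition op_lub :: "'h::complex_hilbert_space oper set \<Rightarrow> 'h oper set \<Rightarrow> 'h oper \<Rightarrow> bool" where
  "op_lub A D x \<longleftrightarrow> x \<in> A \<and> (\<forall>d\<in>D. op_le d x) \<and> (\<forall>y\<in>A. (\<forall>d\<in>D. op_le d y) \<longrightarrow> op_le x y)"


section \<open>Von Neumann algebras and conditional expectations\<close>

definition commutant :: "'h::complex_hilbert_space oper set \<Rightarrow> 'h oper set" where
  "commutant S = {T \<in> bounded_ops. \<forall>s\<in>S. T o\<^sub>L s = s o\<^sub>L T}"

text \<open>A *-subalgebra of \<open>B(H)\<close> equal to its bicommutant; the latter already makes it a unital
  subalgebra.\<close>

definition von_neumann_algebra :: "'h::complex_hilbert_space oper set \<Rightarrow> bool" where
  "von_neumann_algebra M \<longleftrightarrow>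
     M \<subseteq> bounded_ops \<and> (\<forall>x\<in>M. hadj x \<in> M) \<and> commutant (commutant M) = M"

text \<open>Maps between algebras are HOL functions on the ambient operator type; only their values
  on \<open>M\<close> are meaningful.\<close>

definition conditional_expectation ::
    "'h::complex_hilbert_space oper set \<Rightarrow> 'h oper set \<Rightarrow> ('h oper \<Rightarrow> 'h oper) \<Rightarrow> bool" where
  "conditional_expectation M N E \<longleftrightarrow>
     (\<forall>x\<in>M. E x \<in> N) \<and>
     (\<forall>x\<in>M. \<forall>y\<in>M. E (x + y) = E x + E y) \<and>
     (\<forall>c. \<forall>x\<in>M. E (scalar_op c o\<^sub>L x) = scalar_op c o\<^sub>L E x) \<and>
     (\<forall>x\<in>M. positive_op x \<longrightarrow> positive_op (E x)) \<and>
     (\<forall>a\<in>N. E a = a) \<and>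
     (\<forall>a\<in>N. \<forall>b\<in>N. \<forall>x\<in>M. E (a o\<^sub>L x o\<^sub>L b) = a o\<^sub>L E x o\<^sub>L b)"

definition faithful_map ::
    "'h::complex_hilbert_space oper set \<Rightarrow> ('h oper \<Rightarrow> 'h oper) \<Rightarrow> bool" where
  "faithful_map M E \<longleftrightarrow> (\<forall>x\<in>M. E (hadj x o\<^sub>L x) = 0 \<longrightarrow> x = 0)"

text \<open>Normality: \<open>E\<close> preserves suprema of bounded upward directed sets of positive elements.\<close>

definition normal_map ::
    "'h::complex_hilbert_space oper set \<Rightarrow> 'h oper set \<Rightarrow> ('h oper \<Rightarrow> 'h oper) \<Rightarrow> bool" where
  "normal_map M N E \<longleftrightarrow>
     (\<forall>D x. D \<subseteq> M \<longrightarrow> D \<noteq> {} \<longrightarrow> (\<forall>d\<in>D. positive_op d) \<longrightarrow>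
        (\<forall>a\<in>D. \<forall>b\<in>D. \<exists>d\<in>D. op_le a d \<and> op_le b d) \<longrightarrow>
        op_lub M D x \<longrightarrow> op_lub N (E ` D) (E x))"


section \<open>Unitary groups, the orbit and the Weyl group of a conditional expectation\<close>

definition unitaries :: "'h::complex_hilbert_space oper set \<Rightarrow> 'h oper set" where
  "unitaries A = {u \<in> A. hadj u o\<^sub>L u = id_blinfun \<and> u o\<^sub>L hadj u = id_blinfun}"

definition unitary_group :: "'h::complex_hilbert_space oper set \<Rightarrow> 'h oper monoid" where
  "unitary_group A = \<lparr>carrier = unitaries A, mult = (o\<^sub>L), one = id_blinfun\<rparr>"

text \<open>\<open>L\<^sub>u(E)\<close>, restricted to \<open>M\<close> so that equality of HOL functions is equality of maps on \<open>M\<close>.\<close>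

definition conj_map :: "'h::complex_hilbert_space oper set \<Rightarrow> ('h oper \<Rightarrow> 'h oper) \<Rightarrow>
    'h oper \<Rightarrow> ('h oper \<Rightarrow> 'h oper)" where
  "conj_map M E u = (\<lambda>x\<in>M. u o\<^sub>L E (hadj u o\<^sub>L x o\<^sub>L u) o\<^sub>L hadj u)"

definition normalizer_exp ::
    "'h::complex_hilbert_space oper set \<Rightarrow> ('h oper \<Rightarrow> 'h oper) \<Rightarrow> 'h oper set" where
  "normalizer_exp M E =
     {u \<in> unitaries M. \<forall>x\<in>M. E (u o\<^sub>L x o\<^sub>L hadj u) = u o\<^sub>L E x o\<^sub>L hadj u}"

definition centralizer_exp :: "'h::complex_hilbert_space oper set \<Rightarrow> 'h oper set \<Rightarrow>
    ('h oper \<Rightarrow> 'h oper) \<Rightarrow> 'h oper set" where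
  "centralizer_exp M N E = {x \<in> commutant N \<inter> M. \<forall>m\<in>M. E (x o\<^sub>L m) = E (m o\<^sub>L x)}"

definition H_exp :: "'h::complex_hilbert_space oper set \<Rightarrow> 'h oper set \<Rightarrow>
    ('h oper \<Rightarrow> 'h oper) \<Rightarrow> 'h oper set" where
  "H_exp M N E = {v o\<^sub>L w | v w. v \<in> unitaries N \<and> w \<in> unitaries (centralizer_exp M N E)}"

definition weyl_group :: "'h::complex_hilbert_space oper set \<Rightarrow> 'h oper set \<Rightarrow>
    ('h oper \<Rightarrow> 'h oper) \<Rightarrow> 'h oper set monoid" where
  "weyl_group M N E =
     ((unitary_group M)\<lparr>carrier := normalizer_exp M E\<rparr>) Mod H_exp M N E"


section \<open>Quotient topologies and covering maps\<close>

text \<open>The final topology on the image of \<open>f\<close>.\<close>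

definition quotient_topology :: "'a topology \<Rightarrow> ('a \<Rightarrow> 'b) \<Rightarrow> 'b topology" where
  "quotient_topology X f =
     topology (\<lambda>V. V \<subseteq> f ` topspace X \<and> openin X {x \<in> topspace X. f x \<in> V})"

lemma openin_quotient_topology:
  "openin (quotient_topology X f) V \<longleftrightarrow>
     V \<subseteq> f ` topspace X \<and> openin X {x \<in> topspace X. f x \<in> V}"
proof -
  have "istopology (\<lambda>V. V \<subseteq> f ` topspace X \<and> openin X {x \<in> topspace X. f x \<in> V})"
    unfolding istopology_def
  proof (intro conjI allI impI)
    fix S T
    assume S: "S \<subseteq> f ` topspace X \<and> openin X {x \<in> topspace X. f x \<in> S}"
      and T: "T \<subseteq> f ` topspace X \<and> openin X {x \<in> topspace X. f x \<in> T}"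
    have "{x \<in> topspace X. f x \<in> S \<inter> T} =
        {x \<in> topspace X. f x \<in> S} \<inter> {x \<in> topspace X. f x \<in> T}"
      by auto
    moreover have "openin X \<dots>"
      using S T by (intro openin_Int) auto
    ultimately show "openin X {x \<in> topspace X. f x \<in> S \<inter> T}"
      by simp
    show "S \<inter> T \<subseteq> f ` topspace X"
      using S by blast
  next
    fix K
    assume K: "\<forall>S\<in>K. S \<subseteq> f ` topspace X \<and> openin X {x \<in> topspace X. f x \<in> S}"
    have "{x \<in> topspace X. f x \<in> \<Union>K} = (\<Union>S\<in>K. {x \<in> topspace X. f x \<in> S})"
      by auto
    moreover have "openin X \<dots>"
      using K by (intro openin_Union) blast
    ultimately show "openin X {x \<in> topspace X. f x \<in> \<Union>K}"
      by simp
    show "\<Union>K \<subseteq> f ` topspace X"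
      using K by blast
  qed
  then show ?thesis
    by (simp add: quotient_topology_def)
qed

lemma topspace_quotient_topology: "topspace (quotient_topology X f) = f ` topspace X"
proof
  show "topspace (quotient_topology X f) \<subseteq> f ` topspace X"
    using openin_topspace [of "quotient_topology X f"] unfolding openin_quotient_topology
    by (rule conjunct1)
  have "{x \<in> topspace X. f x \<in> f ` topspace X} = topspace X"
    by auto
  then have "openin (quotient_topology X f) (f ` topspace X)"
    by (simp add: openin_quotient_topology)
  then show "f ` topspace X \<subseteq> topspace (quotient_topology X f)"
    by (rule openin_subset)
qed

text \<open>\<^const>\<open>covering_space\<close> for abstract topologies.\<close>

definition covering_map :: "'a topology \<Rightarrow> 'b topology \<Rightarrow> ('a \<Rightarrow> 'b) \<Rightarrow> bool" where
  "covering_map X Y p \<longleftrightarrow>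
     continuous_map X Y p \<and> p ` topspace X = topspace Y \<and>
     (\<forall>y\<in>topspace Y. \<exists>T. y \<in> T \<and> openin Y T \<and>
        (\<exists>\<V>. \<Union>\<V> = topspace X \<inter> p -` T \<and> (\<forall>U\<in>\<V>. openin X U) \<and> pairwise disjnt \<V> \<and>
             (\<forall>U\<in>\<V>. homeomorphic_map (subtopology X U) (subtopology Y T) p)))"

text \<open>Covering transformations, under composition.\<close>

definition deck_group :: "'a topology \<Rightarrow> ('a \<Rightarrow> 'b) \<Rightarrow> ('a \<Rightarrow> 'a) monoid" where
  "deck_group X p = BijGroup (topspace X)
     \<lparr>carrier := {f \<in> Bij (topspace X).
        homeomorphic_map X X f \<and> (\<forall>x\<in>topspace X. p (f x) = p x)}\<rparr>"

definition orbit_space :: "'h::complex_hilbert_space oper set \<Rightarrow> ('h oper \<Rightarrow> 'h oper) \<Rightarrow>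
    ('h oper \<Rightarrow> 'h oper) topology" where
  "orbit_space M E = quotient_topology (top_of_set (unitaries M)) (conj_map M E)"

definition X_space :: "'h::complex_hilbert_space oper set \<Rightarrow> 'h oper set \<Rightarrow>
    ('h oper \<Rightarrow> 'h oper) \<Rightarrow> 'h oper set topology" where
  "X_space M N E = quotient_topology (top_of_set (unitaries M))
     (\<lambda>u. u <#\<^bsub>unitary_group M\<^esub> H_exp M N E)"

text \<open>The right action of the Weyl group: \<open>uH \<cdot> wH = uwH\<close> is the product of the subsets
  \<open>uH\<close> and \<open>wH\<close>, because \<open>H\<close> is normal in the normalizer.\<close>

definition weyl_act :: "'h::complex_hilbert_space oper set \<Rightarrow> 'h oper set \<Rightarrow>
    ('h oper \<Rightarrow> 'h oper) \<Rightarrow> 'h oper set \<Rightarrow> 'h oper set \<Rightarrow> 'h oper set" where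
  "weyl_act M N E C = (\<lambda>A\<in>topspace (X_space M N E). A <#>\<^bsub>unitary_group M\<^esub> C)"

end

theory Submission
  imports Defs
begin

text \<open>A unitary \<open>u\<close> of \<open>M\<close> can be joined to \<open>1\<close> in norm because \<open>M\<close> contains the sign of the
  imaginary part of \<open>u\<close>; so \<open>\<U>\<^sub>M\<close>, and with it \<open>\<X>(E)\<close>, is connected.  If \<open>u\<close> normalizes \<open>E\<close> and is
  close to \<open>1\<close>, then the unitary part \<open>v\<close> of \<open>E u\<close> lies in \<open>N\<close> and \<open>v\<^sup>*u\<close> in the centralizer, so
  \<open>\<H>\<^sub>E\<close> contains a ball of \<open>\<N>\<^sub>E\<close> around \<open>1\<close>.  Since the norm distance on \<open>\<U>\<^sub>M\<close> is bi-invariant, small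
  balls and their translates by \<open>\<N>\<^sub>E\<close> give evenly covered sets for \<open>\<Phi>\<close>.  Every covering
  transformation agrees at one point, hence by connectedness everywhere, with the action of an
  element of \<open>\<N>\<^sub>E\<close>.\<close>

section \<open>Geometry of complex Hilbert spaces\<close>

text \<open>The proof runs without spectral theory, and this shapes its analytic half. Square roots
  come from a polynomial iteration that reaches only operators within norm distance 1 of the
  identity, so every operator whose root is taken is kept in that range; the radius of the ball
  contained in \<open>H_exp\<close> is dictated by this. A sign, by contrast, is in general no norm
  limit of polynomials: it is read off from the projection onto a kernel and lies in
  \<open>M\<close> by the bicommutant property. On the topological side both spaces are quotients of
  the same group, which makes openness of \<Phi> formal; the metric estimate serves to separate the
  sheets. Connectedness is essential for the last claim: on a disconnected space a covering
  transformation could follow different Weyl elements on different components.\<close>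

lemma cinner_add_right: "cinner (x::'h::complex_hilbert_space) (y + z) = cinner x y + cinner x z"
  by (metis cinner_add_left cinner_commute complex_cnj_add)

lemma cinner_scaleC_right: "cinner (x::'h::complex_hilbert_space) (c *\<^sub>C y) = cnj c * cinner x y"
  by (metis cinner_commute cinner_scaleC_left complex_cnj_mult)

lemma cinner_scaleR_left: "cinner (r *\<^sub>R x) (y::'h::complex_hilbert_space) = of_real r * cinner x y"
  by (metis cinner_scaleC_left scaleC_of_real)

lemma cinner_scaleR_right: "cinner (x::'h::complex_hilbert_space) (r *\<^sub>R y) = of_real r * cinner x y"
  using cinner_scaleC_right [of x "of_real r" y] by (simp add: scaleC_of_real)

lemma cinner_minus_left: "cinner (- x) (y::'h::complex_hilbert_space) = - cinner x y"
  using cinner_scaleR_left [of "-1" x y] by simp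

lemma cinner_minus_right: "cinner (x::'h::complex_hilbert_space) (- y) = - cinner x y"
  using cinner_scaleR_right [of x "-1" y] by simp

lemma cinner_zero [simp]: "cinner 0 (y::'h::complex_hilbert_space) = 0" "cinner (y::'h) 0 = 0"
  using cinner_scaleR_left [of 0 0 y] cinner_scaleR_right [of y 0 0] by simp_all

lemma cinner_diff_left: "cinner (x - y) (z::'h::complex_hilbert_space) = cinner x z - cinner y z"
  using cinner_add_left [of x "- y" z] by (simp add: cinner_minus_left)

lemma cinner_diff_right: "cinner (x::'h::complex_hilbert_space) (y - z) = cinner x y - cinner x z"
  using cinner_add_right [of x y "- z"] by (simp add: cinner_minus_right)

lemmas cinner_simps = cinner_add_left cinner_add_right cinner_diff_left cinner_diff_right
  cinner_minus_left cinner_minus_right cinner_scaleC_left cinner_scaleC_right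
  cinner_scaleR_left cinner_scaleR_right

lemma cinner_self: "cinner x (x::'h::complex_hilbert_space) = of_real ((norm x)\<^sup>2)"
proof (rule complex_eqI)
  have "0 \<le> Re (cinner x x)"
    using norm_eq_sqrt_cinner [of x] by (metis norm_ge_zero real_sqrt_ge_0_iff)
  then show "Re (cinner x x) = Re (of_real ((norm x)\<^sup>2))"
    by (simp add: norm_eq_sqrt_cinner [of x])
  have "cnj (cinner x x) = cinner x x"
    by (rule cinner_commute [symmetric])
  then show "Im (cinner x x) = Im (of_real ((norm x)\<^sup>2))"
    by (simp add: complex_eq_iff)
qed

lemma Re_cinner_commute: "Re (cinner y x) = Re (cinner x (y::'h::complex_hilbert_space))"
  by (metis cinner_commute complex_cnj cnj.sel(1))

lemma norm_add_sq:
  "(norm (x + y))\<^sup>2 = (norm x)\<^sup>2 + 2 * Re (cinner x y) + (norm (y::'h::complex_hilbert_space))\<^sup>2"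
proof -
  have "complex_of_real ((norm (x + y))\<^sup>2) = cinner x x + cinner x y + cinner y x + cinner y y"
    by (simp only: cinner_simps add_ac flip: cinner_self)
  then have "Re (complex_of_real ((norm (x + y))\<^sup>2)) = Re (cinner x x) + 2 * Re (cinner x y) + Re (cinner y y)"
    by (simp add: Re_cinner_commute [of y x])
  then show ?thesis
    by (simp add: cinner_self)
qed

lemma norm_diff_sq:
  "(norm (x - y))\<^sup>2 = (norm x)\<^sup>2 - 2 * Re (cinner x y) + (norm (y::'h::complex_hilbert_space))\<^sup>2"
  using norm_add_sq [of x "- y"] by (simp add: cinner_simps)

lemma parallelogram_law:
  "(norm (x + y))\<^sup>2 + (norm (x - y))\<^sup>2 = 2 * (norm x)\<^sup>2 + 2 * (norm (y::'h::complex_hilbert_space))\<^sup>2"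
  by (simp add: norm_add_sq norm_diff_sq)

text \<open>Pythagoras: the subtracted vector is the component of \<open>x\<close> along
  \<open>y\<close>. The same identity yields the Cauchy-Schwarz inequality and the orthogonality of
  nearest points.\<close>

lemma norm_sub_component_sq:
  fixes x y :: "'h::complex_hilbert_space"
  assumes "y \<noteq> 0"
  shows "(norm (x - (cinner x y / of_real ((norm y)\<^sup>2)) *\<^sub>C y))\<^sup>2 =
    (norm x)\<^sup>2 - (cmod (cinner x y))\<^sup>2 / (norm y)\<^sup>2"
proof -
  let ?c = "cinner x y / of_real ((norm y)\<^sup>2)"
  have "cinner x (?c *\<^sub>C y) = cinner x y * cnj (cinner x y) / of_real ((norm y)\<^sup>2)"
    by (simp add: cinner_scaleC_right)
  also have "\<dots> = of_real ((cmod (cinner x y))\<^sup>2 / (norm y)\<^sup>2)"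
    by (simp only: of_real_divide complex_norm_square)
  finally have "cinner x (?c *\<^sub>C y) = of_real ((cmod (cinner x y))\<^sup>2 / (norm y)\<^sup>2)" .
  then have 1: "Re (cinner x (?c *\<^sub>C y)) = (cmod (cinner x y))\<^sup>2 / (norm y)\<^sup>2"
    by simp
  have 2: "(norm (?c *\<^sub>C y))\<^sup>2 = (cmod (cinner x y))\<^sup>2 / (norm y)\<^sup>2"
    using assms by (simp add: norm_scaleC norm_divide norm_power power_mult_distrib
        field_simps)
  show ?thesis
    unfolding norm_diff_sq 1 2 by simp
qed

lemma Cauchy_Schwarz_cinner: "cmod (cinner x y) \<le> norm x * norm (y::'h::complex_hilbert_space)"
proof (cases "y = 0")
  case False
  have "0 \<le> (norm x)\<^sup>2 - (cmod (cinner x y))\<^sup>2 / (norm y)\<^sup>2"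
    using norm_sub_component_sq [OF False, of x] by (metis zero_le_power2)
  then have "(cmod (cinner x y))\<^sup>2 \<le> (norm x * norm y)\<^sup>2"
    using False by (simp add: field_simps power_mult_distrib)
  then show ?thesis
    by (rule power2_le_imp_le) simp
qed simp

lemma bounded_bilinear_cinner:
  "bounded_bilinear (cinner :: 'h::complex_hilbert_space \<Rightarrow> 'h \<Rightarrow> complex)"
proof
  show "\<exists>K. \<forall>a b :: 'h. norm (cinner a b) \<le> norm a * norm b * K"
    by (rule exI [of _ 1]) (simp add: Cauchy_Schwarz_cinner)
qed (simp_all add: cinner_simps scaleR_conv_of_real)

lemma cinner_ext:
  assumes "\<And>x. cinner x y = cinner x (z::'h::complex_hilbert_space)"
  shows "y = z"
proof -
  have "cinner (y - z) (y - z) = 0"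
    using assms [of "y - z"] by (simp add: cinner_simps)
  then show ?thesis
    by (simp add: cinner_self)
qed

section \<open>Nearest points, orthogonal projection and the Riesz representation\<close>

definition closed_csubspace :: "'h::complex_hilbert_space set \<Rightarrow> bool" where
  "closed_csubspace K \<longleftrightarrow>
     closed K \<and> 0 \<in> K \<and> (\<forall>x\<in>K. \<forall>y\<in>K. x + y \<in> K) \<and> (\<forall>c. \<forall>x\<in>K. c *\<^sub>C x \<in> K)"

lemma closed_csubspace_scaleR: "closed_csubspace K \<Longrightarrow> x \<in> K \<Longrightarrow> r *\<^sub>R x \<in> K"
  unfolding closed_csubspace_def by (metis scaleC_of_real)

lemma closed_csubspace_diff:
  assumes K: "closed_csubspace K" and "x \<in> K" "y \<in> K" shows "x - y \<in> K"
proof -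
  have "x + (-1) *\<^sub>R y \<in> K"
    using assms closed_csubspace_scaleR [OF K] unfolding closed_csubspace_def by blast
  then show ?thesis by simp
qed

text \<open>By the parallelogram law two near-minimizers that are far apart would have a midpoint
  below the infimum. So the closed sets \<open>S n\<close> of near-minimizers shrink in diameter,
  and completeness gives a common point.\<close>

lemma closed_csubspace_nearest:
  fixes K :: "'h::complex_hilbert_space set"
  assumes K: "closed_csubspace K"
  shows "\<exists>a\<in>K. \<forall>k\<in>K. norm (x - a) \<le> norm (x - k)"
proof -
  define D where "D = (INF k\<in>K. (norm (x - k))\<^sup>2)"
  have K0: "K \<noteq> {}" and closedK: "closed K"
    using K by (auto simp: closed_csubspace_def)
  have bdd: "bdd_below ((\<lambda>k. (norm (x - k))\<^sup>2) ` K)"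
    by (rule bdd_belowI [of _ 0]) auto
  have D: "D \<le> (norm (x - k))\<^sup>2" if "k \<in> K" for k
    unfolding D_def using bdd that by (rule cINF_lower)
  define S where "S n = {k \<in> K. (norm (x - k))\<^sup>2 \<le> D + 1 / real (Suc n)}" for n
  have cl: "closed (S n)" for n
  proof -
    have "closed (K \<inter> {k. (norm (x - k))\<^sup>2 \<le> D + 1 / real (Suc n)})"
      by (intro closed_Int closedK closed_Collect_le continuous_intros)
    then show ?thesis
      by (simp add: S_def Int_def)
  qed
  have ne: "S n \<noteq> {}" for n
  proof -
    have "D < D + 1 / real (Suc n)" by simp
    then obtain k where "k \<in> K" "(norm (x - k))\<^sup>2 < D + 1 / real (Suc n)"
      using cINF_less_iff [OF K0 bdd, folded D_def] by blast
    then show ?thesis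
      by (auto simp: S_def intro: less_imp_le)
  qed
  have mono: "S n \<subseteq> S m" if "m \<le> n" for m n
  proof -
    have "1 / real (Suc n) \<le> 1 / real (Suc m)"
      using that by (simp add: frac_le)
    then show ?thesis
      by (auto simp: S_def)
  qed
  have small: "\<exists>n. \<forall>k\<in>S n. \<forall>l\<in>S n. dist k l < e" if e: "e > 0" for e
  proof -
    \<comment> \<open>Two squared distances, each at most \<open>1 / Suc n\<close> above
      \<open>D\<close>, enter the parallelogram law with factor 2; after subtracting
      \<open>4 * D\<close> the excess is \<open>4 / Suc n\<close>.\<close>
    obtain n where n: "4 / real (Suc n) < e\<^sup>2"
    proof -
      obtain n where "inverse (real (Suc n)) < e\<^sup>2 / 4"
        using reals_Archimedean [of "e\<^sup>2 / 4"] e by auto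
      then show ?thesis
        using that [of n] by (simp add: field_simps)
    qed
    have "dist k l < e" if kl: "k \<in> S n" "l \<in> S n" for k l
    proof -
      have mid: "(1/2) *\<^sub>R (k + l) \<in> K"
        using kl K closed_csubspace_scaleR [OF K] by (auto simp: S_def closed_csubspace_def)
      have "(x - k) + (x - l) = 2 *\<^sub>R (x - (1/2) *\<^sub>R (k + l))"
        by (simp add: algebra_simps flip: scaleR_2)
      then have "(norm ((x - k) + (x - l)))\<^sup>2 = 4 * (norm (x - (1/2) *\<^sub>R (k + l)))\<^sup>2"
        by (simp add: power_mult_distrib)
      moreover have "\<dots> \<ge> 4 * D"
        using D [OF mid] by simp
      moreover have "(norm ((x - k) - (x - l)))\<^sup>2 = (dist k l)\<^sup>2"
        by (simp add: dist_norm norm_minus_commute)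
      ultimately have "(dist k l)\<^sup>2 \<le> 2 * (norm (x - k))\<^sup>2 + 2 * (norm (x - l))\<^sup>2 - 4 * D"
        using parallelogram_law [of "x - k" "x - l"] by simp
      also have "\<dots> \<le> 4 / real (Suc n)"
        using kl by (simp add: S_def)
      also note n
      finally show ?thesis
        by (rule power2_less_imp_less) (use e in simp)
    qed
    then show ?thesis by blast
  qed
  obtain a where a: "\<And>n. a \<in> S n"
    using decreasing_closed_nest [OF cl ne mono small] by blast
  have "(norm (x - a))\<^sup>2 \<le> D"
  proof (rule field_le_epsilon)
    fix e :: real assume "e > 0"
    then obtain n where "inverse (real (Suc n)) < e"
      using reals_Archimedean by blast
    then show "(norm (x - a))\<^sup>2 \<le> D + e"
      using a [of n] by (simp add: S_def inverse_eq_divide)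
  qed
  then have "norm (x - a) \<le> norm (x - k)" if "k \<in> K" for k
    using power2_le_imp_le [OF order_trans [OF _ D [OF that]]] by simp
  then show ?thesis
    using a [of 0] by (auto simp: S_def)
qed

text \<open>If \<open>x - a\<close> had a component along some \<open>k\<close> in \<open>K\<close>,
  adding it to the nearest point \<open>a\<close> would bring \<open>a\<close> closer to
  \<open>x\<close>.\<close>

lemma orthogonal_projection_exists:
  fixes K :: "'h::complex_hilbert_space set"
  assumes K: "closed_csubspace K"
  shows "\<exists>a\<in>K. \<forall>k\<in>K. cinner (x - a) k = 0"
proof -
  obtain a where a: "a \<in> K" "\<And>k. k \<in> K \<Longrightarrow> norm (x - a) \<le> norm (x - k)"
    using closed_csubspace_nearest [OF K] by blast
  have "cinner (x - a) k = 0" if k: "k \<in> K" for k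
  proof (cases "k = 0")
    case False
    let ?c = "cinner (x - a) k / of_real ((norm k)\<^sup>2)"
    have "a + ?c *\<^sub>C k \<in> K"
      using K a k by (auto simp: closed_csubspace_def)
    from a(2) [OF this] have "(norm (x - a))\<^sup>2 \<le> (norm (x - a - ?c *\<^sub>C k))\<^sup>2"
      by (simp add: diff_diff_eq)
    then have "(cmod (cinner (x - a) k))\<^sup>2 / (norm k)\<^sup>2 \<le> 0"
      unfolding norm_sub_component_sq [OF False] by simp
    then show ?thesis
      using False by (simp add: divide_le_0_iff)
  qed simp
  then show ?thesis
    using a by blast
qed

text \<open>The residual \<open>e\<close> of a vector outside the kernel is orthogonal to the
  kernel, and every vector differs from a multiple of \<open>e\<close> by a kernel vector. Hence the
  functional is a multiple of the product with \<open>e\<close>; the factor is fixed by evaluating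
  at \<open>e\<close>.\<close>

lemma Riesz_representation:
  fixes \<phi> :: "'h::complex_hilbert_space \<Rightarrow> complex"
  assumes \<phi>: "bounded_linear \<phi>" and homogeneous: "\<And>c x. \<phi> (c *\<^sub>C x) = c * \<phi> x"
  shows "\<exists>z. \<forall>x. \<phi> x = cinner x z"
proof (cases "\<forall>x. \<phi> x = 0")
  case True
  then show ?thesis by (intro exI [of _ 0]) simp
next
  case False
  then obtain w where w: "\<phi> w \<noteq> 0" by blast
  interpret bounded_linear \<phi> by fact
  have "closed {x. \<phi> x = 0}"
    by (intro closed_Collect_eq continuous_on continuous_intros)
  then have "closed_csubspace {x. \<phi> x = 0}"
    by (simp add: closed_csubspace_def add homogeneous zero)
  then obtain a where a: "\<phi> a = 0" and orth: "\<And>k. \<phi> k = 0 \<Longrightarrow> cinner (w - a) k = 0"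
    using orthogonal_projection_exists [of "{x. \<phi> x = 0}" w] by auto
  define e where "e = w - a"
  have e: "\<phi> e \<noteq> 0" "norm e \<noteq> 0"
    using a w zero by (auto simp: e_def diff)
  show ?thesis
  proof (intro exI allI)
    fix x
    have "\<phi> (x - (\<phi> x / \<phi> e) *\<^sub>C e) = 0"
      using e by (simp add: diff homogeneous)
    then have "cinner e (x - (\<phi> x / \<phi> e) *\<^sub>C e) = 0"
      using orth by (simp add: e_def)
    then have "cinner (x - (\<phi> x / \<phi> e) *\<^sub>C e) e = 0"
      by (metis cinner_commute complex_cnj_zero)
    then have "cinner x e = (\<phi> x / \<phi> e) * of_real ((norm e)\<^sup>2)"
      by (simp add: cinner_simps cinner_self)
    then show "\<phi> x = cinner x (cnj (\<phi> e / of_real ((norm e)\<^sup>2)) *\<^sub>C e)"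
      using e by (simp add: cinner_scaleC_right)
  qed
qed

section \<open>Adjoints and commutants\<close>

lemma bounded_opsD: "T \<in> bounded_ops \<Longrightarrow> T (c *\<^sub>C x) = c *\<^sub>C T x"
  by (simp add: bounded_ops_def)

text \<open>\<open>hadj\<close> is a definite description, and this is the existence half that it
  rests on. Riesz gives the values of \<open>s\<close> pointwise; pairing with \<open>s x\<close>
  itself bounds them.\<close>

lemma adjoint_exists:
  fixes T :: "'h::complex_hilbert_space oper"
  assumes T: "T \<in> bounded_ops"
  shows "\<exists>S\<in>bounded_ops. \<forall>x y. cinner (T x) y = cinner x (S y)"
proof -
  have "\<exists>z. \<forall>x. cinner (T x) y = cinner x z" for y
  proof (rule Riesz_representation)
    show "bounded_linear (\<lambda>x. cinner (T x) y)"
      using bounded_linear_compose [OF bounded_bilinear.bounded_linear_left [OF bounded_bilinear_cinner]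
          blinfun.bounded_linear_right] .
  qed (simp add: bounded_opsD [OF T] cinner_simps)
  then obtain s where s: "\<And>x y. cinner (T x) y = cinner x (s y)"
    by metis
  have add: "s (x + y) = s x + s y" for x y
    by (rule cinner_ext) (simp add: cinner_simps flip: s)
  have scaleC: "s (c *\<^sub>C x) = c *\<^sub>C s x" for c x
    by (rule cinner_ext) (simp add: cinner_simps flip: s)
  have "bounded_linear s"
  proof (rule bounded_linear_intro)
    show "s (r *\<^sub>R x) = r *\<^sub>R s x" for r x
      by (metis scaleC scaleC_of_real)
    show "norm (s x) \<le> norm x * norm T" for x
    proof (cases "s x = 0")
      case False
      have "cmod (cinner (T (s x)) x) = (norm (s x))\<^sup>2"
        by (simp add: s cinner_self norm_power)
      moreover have "cmod (cinner (T (s x)) x) \<le> norm (T (s x)) * norm x"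
        by (rule Cauchy_Schwarz_cinner)
      moreover have "\<dots> \<le> norm T * norm (s x) * norm x"
        by (intro mult_right_mono norm_blinfun) simp
      ultimately have "norm (s x) * norm (s x) \<le> norm (s x) * (norm x * norm T)"
        by (simp add: power2_eq_square mult_ac)
      then show ?thesis
        using False by simp
    qed simp
  qed (rule add)
  then show ?thesis
    using s scaleC by (intro bexI [of _ "Blinfun s"])
      (simp_all add: bounded_ops_def bounded_linear_Blinfun_apply)
qed

lemma hadj_eqI:
  fixes T S :: "'h::complex_hilbert_space oper"
  assumes "\<And>x y. cinner (T x) y = cinner x (S y)"
  shows "hadj T = S"
  unfolding hadj_def
proof (rule the_equality)
  fix R :: "'h oper" assume "\<forall>x y. cinner (T x) y = cinner x (R y)"
  then have "cinner x (R y) = cinner x (S y)" for x y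
    using assms by simp
  then show "R = S"
    by (meson blinfun_eqI cinner_ext)
qed (use assms in blast)

lemma
  assumes T: "T \<in> bounded_ops"
  shows hadj_bounded_ops: "hadj T \<in> bounded_ops"
    and cinner_hadj_right: "cinner x (hadj T y) = cinner (T x) y"
proof -
  obtain S where S: "S \<in> bounded_ops" "\<And>x y. cinner (T x) y = cinner x (S y)"
    using adjoint_exists [OF T] by blast
  then have "hadj T = S"
    by (intro hadj_eqI) simp
  then show "hadj T \<in> bounded_ops" "cinner x (hadj T y) = cinner (T x) y"
    using S by simp_all
qed

lemma cinner_hadj_left:
  assumes "T \<in> bounded_ops" shows "cinner (hadj T x) y = cinner x (T y)"
  unfolding cinner_commute [of "hadj T x"] cinner_hadj_right [OF assms]
  by (rule cinner_commute [symmetric])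

lemma scaleC_scaleR_commute: "c *\<^sub>C r *\<^sub>R x = r *\<^sub>R c *\<^sub>C (x::'h::complex_hilbert_space)"
  by (metis mult.commute scaleC_of_real scaleC_scaleC)

lemma scaleC_linear:
  "c *\<^sub>C (x - y) = c *\<^sub>C x - c *\<^sub>C (y::'h::complex_hilbert_space)"
  "c *\<^sub>C (- x) = - (c *\<^sub>C x)" "c *\<^sub>C 0 = (0::'h)"
  using linear_diff linear_neg linear_0 bounded_linear.linear [OF bounded_linear_scaleC] by blast+

lemma bounded_ops_closure:
  fixes S T :: "'h::complex_hilbert_space oper"
  shows "S \<in> bounded_ops \<Longrightarrow> T \<in> bounded_ops \<Longrightarrow> S + T \<in> bounded_ops"
    "S \<in> bounded_ops \<Longrightarrow> T \<in> bounded_ops \<Longrightarrow> S - T \<in> bounded_ops"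
    "S \<in> bounded_ops \<Longrightarrow> T \<in> bounded_ops \<Longrightarrow> S o\<^sub>L T \<in> bounded_ops"
    "S \<in> bounded_ops \<Longrightarrow> r *\<^sub>R S \<in> bounded_ops"
    "S \<in> bounded_ops \<Longrightarrow> - S \<in> bounded_ops"
    "(id_blinfun :: 'h oper) \<in> bounded_ops" "(0 :: 'h oper) \<in> bounded_ops"
    "(scalar_op c :: 'h oper) \<in> bounded_ops"
  by (auto simp: bounded_ops_def blinfun.bilinear_simps scaleC_add_right scaleC_linear
      scaleC_scaleR_commute scalar_op_apply scaleC_scaleC mult.commute)

lemma hadj_add: "S \<in> bounded_ops \<Longrightarrow> T \<in> bounded_ops \<Longrightarrow> hadj (S + T) = hadj S + hadj T"
  by (rule hadj_eqI) (simp add: blinfun.bilinear_simps cinner_simps cinner_hadj_right)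

lemma hadj_diff: "S \<in> bounded_ops \<Longrightarrow> T \<in> bounded_ops \<Longrightarrow> hadj (S - T) = hadj S - hadj T"
  by (rule hadj_eqI) (simp add: blinfun.bilinear_simps cinner_simps cinner_hadj_right)

lemma hadj_compose: "S \<in> bounded_ops \<Longrightarrow> T \<in> bounded_ops \<Longrightarrow> hadj (S o\<^sub>L T) = hadj T o\<^sub>L hadj S"
  by (rule hadj_eqI) (simp add: cinner_hadj_right)

lemma hadj_scaleR: "S \<in> bounded_ops \<Longrightarrow> hadj (r *\<^sub>R S) = r *\<^sub>R hadj S"
  by (rule hadj_eqI) (simp add: blinfun.bilinear_simps cinner_simps cinner_hadj_right)

lemma hadj_scalar_op: "hadj (scalar_op c) = scalar_op (cnj c)"
  by (rule hadj_eqI) (simp add: scalar_op_apply cinner_simps)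

lemma hadj_id [simp]: "hadj id_blinfun = id_blinfun"
  by (rule hadj_eqI) simp

lemma hadj_zero [simp]: "hadj 0 = 0"
  by (rule hadj_eqI) simp

lemma hadj_hadj: "T \<in> bounded_ops \<Longrightarrow> hadj (hadj T) = T"
  by (rule hadj_eqI) (simp add: cinner_hadj_left)

lemma norm_hadj_le:
  fixes T :: "'h::complex_hilbert_space oper"
  assumes T: "T \<in> bounded_ops"
  shows "norm (hadj T) \<le> norm T"
proof (rule norm_blinfun_bound)
  fix y :: 'h
  have "(norm (hadj T y))\<^sup>2 = cmod (cinner (T (hadj T y)) y)"
    unfolding cinner_hadj_right [OF T, symmetric] cinner_self by (simp add: norm_power)
  also have "\<dots> \<le> norm (T (hadj T y)) * norm y"
    by (rule Cauchy_Schwarz_cinner)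
  also have "\<dots> \<le> norm T * norm (hadj T y) * norm y"
    by (intro mult_right_mono norm_blinfun) simp
  finally have "norm (hadj T y) * norm (hadj T y) \<le> norm (hadj T y) * (norm T * norm y)"
    by (simp add: power2_eq_square mult_ac)
  then show "norm (hadj T y) \<le> norm T * norm y"
    by (cases "hadj T y = 0") (auto simp del: hadj_zero)
qed simp

lemma norm_hadj: "T \<in> bounded_ops \<Longrightarrow> norm (hadj T) = norm T"
  by (metis hadj_bounded_ops hadj_hadj norm_hadj_le order_antisym)

lemma cinner_hadj_compose_self:
  "T \<in> bounded_ops \<Longrightarrow> cinner ((hadj T o\<^sub>L T) x) x = of_real ((norm (T x))\<^sup>2)"
  by (simp add: cinner_hadj_left cinner_self)

text \<open>Polarization. The defects of symmetry at \<open>(x, y)\<close> and \<open>(y, x)\<close>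
  cancel by the hypothesis at \<open>x + y\<close>; replacing \<open>y\<close> by
  \<open>\<i> *\<^sub>C y\<close> multiplies them by opposite phases, so they are also equal, hence
  zero.\<close>

lemma self_adjointI:
  fixes T :: "'h::complex_hilbert_space oper"
  assumes T: "T \<in> bounded_ops" and re: "\<And>x. cinner (T x) x \<in> \<real>"
  shows "hadj T = T"
proof (rule hadj_eqI)
  have sym: "cinner (T x) x = cinner x (T x)" for x
    using re [of x] by (metis Reals_cnj_iff cinner_commute)
  fix x y
  define d where "d = cinner (T x) y - cinner x (T y)"
  define d' where "d' = cinner (T y) x - cinner y (T x)"
  have "d + d' = 0"
    using sym [of "x + y"] sym [of x] sym [of y]
    by (simp add: d_def d'_def blinfun.bilinear_simps cinner_simps algebra_simps)
  moreover have "cnj \<i> * d + \<i> * d' = 0"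
    using sym [of "x + \<i> *\<^sub>C y"] sym [of x] sym [of y]
    by (simp add: d_def d'_def blinfun.bilinear_simps cinner_simps bounded_opsD [OF T] algebra_simps)
  ultimately have "d = 0"
    by (simp add: complex_eq_iff)
  then show "cinner (T x) y = cinner x (T y)"
    by (simp add: d_def)
qed

section \<open>Composition, commutants and the bicommutant\<close>

lemmas compose_simps =
  bounded_bilinear.add_left [OF bounded_bilinear_blinfun_compose]
  bounded_bilinear.add_right [OF bounded_bilinear_blinfun_compose]
  bounded_bilinear.diff_left [OF bounded_bilinear_blinfun_compose]
  bounded_bilinear.diff_right [OF bounded_bilinear_blinfun_compose]
  bounded_bilinear.minus_left [OF bounded_bilinear_blinfun_compose]
  bounded_bilinear.minus_right [OF bounded_bilinear_blinfun_compose]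
  bounded_bilinear.scaleR_left [OF bounded_bilinear_blinfun_compose]
  bounded_bilinear.scaleR_right [OF bounded_bilinear_blinfun_compose]

lemma compose_id [simp]: "T o\<^sub>L id_blinfun = T" "id_blinfun o\<^sub>L T = T"
  by (simp_all add: blinfun_eqI)

lemma compose_assoc: "(R o\<^sub>L S) o\<^sub>L T = R o\<^sub>L (S o\<^sub>L T)"
  by (simp add: blinfun_eqI)

lemma scalar_op_commute: "T \<in> bounded_ops \<Longrightarrow> T o\<^sub>L scalar_op c = scalar_op c o\<^sub>L T"
  by (rule blinfun_eqI) (simp add: scalar_op_apply bounded_opsD)

lemma scalar_op_compose: "scalar_op c o\<^sub>L scalar_op d = scalar_op (c * d)"
  by (rule blinfun_eqI) (simp add: scalar_op_apply scaleC_scaleC)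

lemma scalar_op_of_real: "scalar_op (of_real r) = r *\<^sub>R id_blinfun"
  by (rule blinfun_eqI) (simp add: scalar_op_apply scaleC_of_real blinfun.bilinear_simps)

lemma commutantD: "T \<in> commutant S \<Longrightarrow> s \<in> S \<Longrightarrow> T o\<^sub>L s = s o\<^sub>L T"
  by (simp add: commutant_def)

lemma commutant_closure:
  assumes "x \<in> commutant S" "y \<in> commutant S"
  shows "x + y \<in> commutant S" "x - y \<in> commutant S" "x o\<^sub>L y \<in> commutant S"
    "r *\<^sub>R x \<in> commutant S" "- x \<in> commutant S"
proof -
  have "x o\<^sub>L y o\<^sub>L s = s o\<^sub>L (x o\<^sub>L y)" if "s \<in> S" for s
    using assms that by (metis commutantD compose_assoc)
  then show "x + y \<in> commutant S" "x - y \<in> commutant S" "x o\<^sub>L y \<in> commutant S"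
    "r *\<^sub>R x \<in> commutant S" "- x \<in> commutant S"
    using assms by (auto simp: commutant_def bounded_ops_closure compose_simps)
qed

lemma von_neumann_algebra_closure:
  assumes M: "von_neumann_algebra M"
  shows "x \<in> M \<Longrightarrow> y \<in> M \<Longrightarrow> x + y \<in> M" "x \<in> M \<Longrightarrow> y \<in> M \<Longrightarrow> x - y \<in> M"
    "x \<in> M \<Longrightarrow> y \<in> M \<Longrightarrow> x o\<^sub>L y \<in> M" "x \<in> M \<Longrightarrow> r *\<^sub>R x \<in> M" "x \<in> M \<Longrightarrow> - x \<in> M"
    "x \<in> M \<Longrightarrow> hadj x \<in> M" "x \<in> M \<Longrightarrow> x \<in> bounded_ops"
    "id_blinfun \<in> M" "scalar_op c \<in> M"
proof -
  have MM: "commutant (commutant M) = M" and bdd: "M \<subseteq> bounded_ops"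
    using M by (auto simp: von_neumann_algebra_def)
  show "x \<in> M \<Longrightarrow> y \<in> M \<Longrightarrow> x + y \<in> M" "x \<in> M \<Longrightarrow> y \<in> M \<Longrightarrow> x - y \<in> M"
    "x \<in> M \<Longrightarrow> y \<in> M \<Longrightarrow> x o\<^sub>L y \<in> M" "x \<in> M \<Longrightarrow> r *\<^sub>R x \<in> M" "x \<in> M \<Longrightarrow> - x \<in> M"
    using commutant_closure [of x "commutant M" y] commutant_closure [of x "commutant M" x] MM
    by auto
  show "x \<in> M \<Longrightarrow> hadj x \<in> M" "x \<in> M \<Longrightarrow> x \<in> bounded_ops"
    using M by (auto simp: von_neumann_algebra_def)
  have "id_blinfun \<in> commutant (commutant M)" "scalar_op c \<in> commutant (commutant M)"
    by (auto simp: commutant_def bounded_ops_closure scalar_op_commute)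
  then show "id_blinfun \<in> M" "scalar_op c \<in> M"
    by (simp_all only: MM)
qed

text \<open>The way an operator constructed from \<open>x\<close>, such as a root or an inverse, is
  put back into the algebra: whatever commutes with \<open>x\<close> has to commute with it.\<close>

lemma von_neumann_algebra_memI:
  assumes "von_neumann_algebra M" "x \<in> M" "y \<in> bounded_ops"
    and "\<And>T. T \<in> commutant M \<Longrightarrow> T o\<^sub>L x = x o\<^sub>L T \<Longrightarrow> T o\<^sub>L y = y o\<^sub>L T"
  shows "y \<in> M"
proof -
  have "y \<in> commutant (commutant M)"
    using assms by (auto simp: commutant_def)
  then show ?thesis
    using assms(1) by (simp add: von_neumann_algebra_def)
qed

text \<open>Supplies the conditions on \<open>hadj T\<close> in \<open>sign_exists\<close>, and
  stability of \<open>commutant N\<close> under adjoints for the subgroup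
  \<open>H_exp\<close>.\<close>

lemma hadj_commutant:
  assumes M: "von_neumann_algebra M" and T: "T \<in> commutant M"
  shows "hadj T \<in> commutant M"
proof -
  have Tb: "T \<in> bounded_ops"
    using T by (simp add: commutant_def)
  have "hadj T o\<^sub>L x = x o\<^sub>L hadj T" if "x \<in> M" for x
  proof -
    have "hadj (T o\<^sub>L hadj x) = hadj (hadj x o\<^sub>L T)"
      using T M that by (metis commutantD von_neumann_algebra_closure(6))
    then show ?thesis
      using Tb von_neumann_algebra_closure(7) [OF M that]
      by (simp add: hadj_compose hadj_hadj hadj_bounded_ops)
  qed
  then show ?thesis
    using Tb by (simp add: commutant_def hadj_bounded_ops)
qed

section \<open>Square roots and signs of operators\<close>

text \<open>The iteration \<open>y \<mapsto> (x + y\<^sup>2)/2\<close> converges in norm to \<open>1 - \<surd>(1 - x)\<close> for \<open>\<parallel>x\<parallel> \<le> 1\<close>,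
  because it is dominated by the scalar iteration for \<open>x = 1\<close>, which converges to \<open>1\<close>.\<close>

primrec sqrt_iter :: "'h::complex_hilbert_space oper \<Rightarrow> nat \<Rightarrow> 'h oper" where
  "sqrt_iter x 0 = 0"
| "sqrt_iter x (Suc n) = (1/2) *\<^sub>R (x + (sqrt_iter x n o\<^sub>L sqrt_iter x n))"

primrec sqrt_bound :: "nat \<Rightarrow> real" where
  "sqrt_bound 0 = 0"
| "sqrt_bound (Suc n) = (1 + (sqrt_bound n)\<^sup>2) / 2"

lemma sqrt_bound_range: "0 \<le> sqrt_bound n \<and> sqrt_bound n \<le> 1"
proof (induction n)
  case (Suc n)
  then have "(sqrt_bound n)\<^sup>2 \<le> 1"
    by (simp add: power_le_one)
  then show ?case by simp
qed simp

lemma sqrt_bound_le_Suc: "sqrt_bound n \<le> sqrt_bound (Suc n)"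
proof -
  have "sqrt_bound (Suc n) - sqrt_bound n = (1 - sqrt_bound n)\<^sup>2 / 2"
    by (simp add: power2_eq_square field_simps)
  moreover have "\<dots> \<ge> 0" by simp
  ultimately show ?thesis by linarith
qed

lemma sqrt_bound_tendsto: "sqrt_bound \<longlonglongrightarrow> 1"
proof -
  have "incseq sqrt_bound"
    by (rule incseq_SucI) (rule sqrt_bound_le_Suc)
  then obtain L where L: "sqrt_bound \<longlonglongrightarrow> L"
    using incseq_convergent [of sqrt_bound 1] sqrt_bound_range by metis
  have "(\<lambda>n. sqrt_bound (Suc n)) \<longlonglongrightarrow> (1 + L\<^sup>2) / 2"
    unfolding sqrt_bound.simps by (intro tendsto_intros L) simp
  then have "L = (1 + L\<^sup>2) / 2"
    using LIMSEQ_unique LIMSEQ_Suc [OF L] by blast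
  then have "(L - 1)\<^sup>2 = 0"
    by (simp add: power2_eq_square field_simps)
  then show ?thesis
    using L by simp
qed

lemma norm_sqrt_iter:
  assumes x: "norm x \<le> 1"
  shows "norm (sqrt_iter x n) \<le> sqrt_bound n"
proof (induction n)
  case (Suc n)
  have "norm (sqrt_iter x n o\<^sub>L sqrt_iter x n) \<le> norm (sqrt_iter x n) * norm (sqrt_iter x n)"
    by (rule norm_blinfun_compose)
  also have "\<dots> \<le> (sqrt_bound n)\<^sup>2"
    unfolding power2_eq_square using Suc by (intro mult_mono) (auto simp: sqrt_bound_range)
  finally show ?case
    using x norm_triangle_ineq [of x "sqrt_iter x n o\<^sub>L sqrt_iter x n"] by simp
qed simp

text \<open>The difference of squares is split as \<open>(z - y) z + y (z - y)\<close>, which is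
  valid for noncommuting operators; the resulting bound \<open>(t - s) (t + s) / 2\<close> is
  exactly the next scalar increment.\<close>

lemma norm_sqrt_iter_step:
  assumes x: "norm x \<le> 1"
  shows "norm (sqrt_iter x (Suc n) - sqrt_iter x n) \<le> sqrt_bound (Suc n) - sqrt_bound n"
proof (induction n)
  case (Suc n)
  let ?y = "sqrt_iter x n" and ?z = "sqrt_iter x (Suc n)"
  let ?s = "sqrt_bound n" and ?t = "sqrt_bound (Suc n)"
  have z: "norm ?z \<le> ?t" and y: "norm ?y \<le> ?s"
    using norm_sqrt_iter [OF x] by blast+
  have "norm ((?z - ?y) o\<^sub>L ?z) \<le> (?t - ?s) * ?t"
    by (intro order_trans [OF norm_blinfun_compose] mult_mono Suc z) (use sqrt_bound_le_Suc in auto)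
  moreover have "norm (?y o\<^sub>L (?z - ?y)) \<le> ?s * (?t - ?s)"
    by (intro order_trans [OF norm_blinfun_compose] mult_mono Suc y) (use sqrt_bound_range in auto)
  moreover have "sqrt_iter x (Suc (Suc n)) - ?z = (1/2) *\<^sub>R (((?z - ?y) o\<^sub>L ?z) + (?y o\<^sub>L (?z - ?y)))"
    unfolding sqrt_iter.simps(2) [of x "Suc n"]
    by (subst (3) sqrt_iter.simps(2)) (simp add: compose_simps algebra_simps del: sqrt_iter.simps)
  ultimately have "norm (sqrt_iter x (Suc (Suc n)) - ?z) \<le> ((?t - ?s) * ?t + ?s * (?t - ?s)) / 2"
    using norm_triangle_ineq [of "(?z - ?y) o\<^sub>L ?z" "?y o\<^sub>L (?z - ?y)"] by simp
  also have "\<dots> = sqrt_bound (Suc (Suc n)) - ?t"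
    unfolding sqrt_bound.simps(2) [of "Suc n"]
    using sqrt_bound.simps(2) [of n]
    by (simp add: power2_eq_square field_simps del: sqrt_bound.simps)
  finally show ?case .
qed (use x in simp)

text \<open>The bound does not depend on \<open>x\<close>. It therefore gives convergence of the
  iteration and, later, norm continuity of the root.\<close>

lemma norm_sqrt_iter_diff:
  assumes x: "norm x \<le> 1"
  shows "norm (sqrt_iter x (n + k) - sqrt_iter x n) \<le> sqrt_bound (n + k) - sqrt_bound n"
proof (induction k)
  case (Suc k)
  have "norm (sqrt_iter x (n + Suc k) - sqrt_iter x n) \<le>
      norm (sqrt_iter x (Suc (n + k)) - sqrt_iter x (n + k)) + norm (sqrt_iter x (n + k) - sqrt_iter x n)"
    using norm_triangle_ineq [of "sqrt_iter x (Suc (n + k)) - sqrt_iter x (n + k)"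
        "sqrt_iter x (n + k) - sqrt_iter x n"] by (simp del: sqrt_iter.simps)
  also have "\<dots> \<le> (sqrt_bound (Suc (n + k)) - sqrt_bound (n + k)) + (sqrt_bound (n + k) - sqrt_bound n)"
    by (intro add_mono Suc norm_sqrt_iter_step x)
  finally show ?case by simp
qed simp

lemma sqrt_iter_convergent:
  assumes x: "norm x \<le> 1"
  shows "sqrt_iter x \<longlonglongrightarrow> lim (sqrt_iter x)"
proof -
  have "Cauchy (sqrt_iter x)"
  proof (rule metric_CauchyI)
    fix e :: real assume e: "0 < e"
    obtain N where N: "\<And>n. n \<ge> N \<Longrightarrow> \<bar>sqrt_bound n - 1\<bar> < e / 2"
      using LIMSEQ_D [OF sqrt_bound_tendsto, of "e/2"] e by auto
    have near: "dist (sqrt_iter x n) (sqrt_iter x N) < e / 2" if "n \<ge> N" for n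
    proof -
      have "dist (sqrt_iter x n) (sqrt_iter x N) \<le> sqrt_bound n - sqrt_bound N"
        using norm_sqrt_iter_diff [OF x, of N "n - N"] that by (simp add: dist_norm)
      also have "\<dots> < e / 2"
        using N [of N] sqrt_bound_range [of n] by linarith
      finally show ?thesis .
    qed
    show "\<exists>M. \<forall>m\<ge>M. \<forall>n\<ge>M. dist (sqrt_iter x m) (sqrt_iter x n) < e"
      using near dist_triangle_half_l by blast
  qed
  then show ?thesis
    by (simp add: Cauchy_convergent_iff convergent_LIMSEQ_iff)
qed

text \<open>With \<open>y = 1 - r\<close> the equation \<open>r^2 = x\<close> reads
  \<open>y = ((1 - x) + y^2) / 2\<close>, the fixed point equation of the iteration started from
  \<open>1 - x\<close>. The value is used only when \<open>1 - x\<close> has norm at most 1.\<close>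

definition sqrt_op :: "'h::complex_hilbert_space oper \<Rightarrow> 'h oper" where
  "sqrt_op x = id_blinfun - lim (sqrt_iter (id_blinfun - x))"

lemma sqrt_op_tendsto:
  assumes "norm (id_blinfun - x) \<le> 1"
  shows "(\<lambda>n. id_blinfun - sqrt_iter (id_blinfun - x) n) \<longlonglongrightarrow> sqrt_op x"
  unfolding sqrt_op_def by (intro tendsto_intros sqrt_iter_convergent assms)

lemma sqrt_op_square:
  assumes x: "norm (id_blinfun - x) \<le> 1"
  shows "sqrt_op x o\<^sub>L sqrt_op x = x"
proof -
  define y where "y = lim (sqrt_iter (id_blinfun - x))"
  have y: "sqrt_iter (id_blinfun - x) \<longlonglongrightarrow> y"
    unfolding y_def by (rule sqrt_iter_convergent [OF x])
  have "(\<lambda>n. sqrt_iter (id_blinfun - x) (Suc n)) \<longlonglongrightarrow> (1/2) *\<^sub>R ((id_blinfun - x) + (y o\<^sub>L y))"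
    unfolding sqrt_iter.simps
    by (intro tendsto_intros y bounded_bilinear.tendsto [OF bounded_bilinear_blinfun_compose])
  then have eq: "y = (1/2) *\<^sub>R ((id_blinfun - x) + (y o\<^sub>L y))"
    using LIMSEQ_unique LIMSEQ_Suc [OF y] by blast
  have "2 *\<^sub>R y = id_blinfun - x + (y o\<^sub>L y)"
    by (subst eq) simp
  then show ?thesis
    unfolding sqrt_op_def y_def [symmetric] by (simp add: compose_simps scaleR_2 algebra_simps)
qed

lemma sqrt_op_commute:
  assumes x: "norm (id_blinfun - x) \<le> 1" and T: "T o\<^sub>L x = x o\<^sub>L T"
  shows "T o\<^sub>L sqrt_op x = sqrt_op x o\<^sub>L T"
proof -
  have iter: "T o\<^sub>L sqrt_iter (id_blinfun - x) n = sqrt_iter (id_blinfun - x) n o\<^sub>L T" for n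
  proof (induction n)
    case (Suc n)
    then have "T o\<^sub>L (sqrt_iter (id_blinfun - x) n o\<^sub>L sqrt_iter (id_blinfun - x) n) =
        (sqrt_iter (id_blinfun - x) n o\<^sub>L sqrt_iter (id_blinfun - x) n) o\<^sub>L T"
      by (metis compose_assoc)
    then show ?case
      using T by (simp add: compose_simps)
  qed simp
  have "(\<lambda>n. T o\<^sub>L (id_blinfun - sqrt_iter (id_blinfun - x) n)) \<longlonglongrightarrow> (T o\<^sub>L sqrt_op x)"
    "(\<lambda>n. (id_blinfun - sqrt_iter (id_blinfun - x) n) o\<^sub>L T) \<longlonglongrightarrow> (sqrt_op x o\<^sub>L T)"
    by (intro tendsto_intros sqrt_op_tendsto x
        bounded_bilinear.tendsto [OF bounded_bilinear_blinfun_compose])+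
  then show ?thesis
    using LIMSEQ_unique by (simp add: compose_simps iter)
qed

text \<open>Complex linearity becomes a commutation property, so it passes to roots and inverses by
  \<open>sqrt_op_commute\<close> and \<open>commute_inverse\<close> like any other
  commutation.\<close>

lemma bounded_ops_iff_commute:
  "T \<in> bounded_ops \<longleftrightarrow> (\<forall>c. scalar_op c o\<^sub>L T = T o\<^sub>L scalar_op c)"
proof
  assume *: "\<forall>c. scalar_op c o\<^sub>L T = T o\<^sub>L scalar_op c"
  have "T (c *\<^sub>C x) = c *\<^sub>C T x" for c x
    using arg_cong [OF spec [OF *, of c], of "\<lambda>S. S x"] by (simp add: scalar_op_apply)
  then show "T \<in> bounded_ops"
    by (simp add: bounded_ops_def)
qed (simp add: scalar_op_commute)

lemma sqrt_op_bounded_ops: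
  assumes "norm (id_blinfun - x) \<le> 1" "x \<in> bounded_ops"
  shows "sqrt_op x \<in> bounded_ops"
  using assms sqrt_op_commute unfolding bounded_ops_iff_commute by blast

lemma hadj_sqrt_op:
  assumes x: "norm (id_blinfun - x) \<le> 1" and xb: "x \<in> bounded_ops" and adj: "hadj x = x"
  shows "hadj (sqrt_op x) = sqrt_op x"
proof (rule hadj_eqI)
  let ?y = "sqrt_iter (id_blinfun - x)"
  have sym: "?y n \<in> bounded_ops \<and> hadj (?y n) = ?y n" for n
    by (induction n)
      (use xb adj in \<open>auto simp: bounded_ops_closure hadj_add hadj_diff hadj_compose hadj_scaleR\<close>)
  fix u v
  have lim: "(\<lambda>n. cinner ((id_blinfun - ?y n) u) v) \<longlonglongrightarrow> cinner (sqrt_op x u) v"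
    "(\<lambda>n. cinner u ((id_blinfun - ?y n) v)) \<longlonglongrightarrow> cinner u (sqrt_op x v)"
    by (intro bounded_bilinear.tendsto [OF bounded_bilinear_cinner] tendsto_const
        blinfun.tendsto sqrt_op_tendsto x)+
  have "cinner ((id_blinfun - ?y n) u) v = cinner u ((id_blinfun - ?y n) v)" for n
    using sym [of n] cinner_hadj_right [of "?y n" u v] by (simp add: blinfun.bilinear_simps cinner_simps)
  then show "cinner (sqrt_op x u) v = cinner u (sqrt_op x v)"
    using lim LIMSEQ_unique by simp
qed

lemma sqrt_op_vna:
  assumes M: "von_neumann_algebra M" and "x \<in> M" "norm (id_blinfun - x) \<le> 1"
  shows "sqrt_op x \<in> M"
  using assms sqrt_op_commute sqrt_op_bounded_ops von_neumann_algebra_closure(7) [OF M]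
  by (intro von_neumann_algebra_memI [OF M \<open>x \<in> M\<close>]) blast+

lemma sqrt_op_id [simp]: "sqrt_op id_blinfun = id_blinfun"
proof -
  have "sqrt_iter (0 :: 'a oper) n = 0" for n
    by (induction n) simp_all
  then have "sqrt_iter (0 :: 'a oper) = (\<lambda>n. 0)" by blast
  then show ?thesis
    by (simp add: sqrt_op_def)
qed

text \<open>Each iterate is a polynomial in \<open>x\<close>, and the tail is at most
  \<open>1 - sqrt_bound n\<close> uniformly in \<open>x\<close>. Continuity makes the path of
  unitaries through the roots \<open>c t\<close> norm continuous.\<close>

lemma continuous_on_sqrt_op: "continuous_on {x. norm (id_blinfun - x) \<le> 1} sqrt_op"
proof (rule uniform_limit_theorem [where F = sequentially
      and f = "\<lambda>n x. id_blinfun - sqrt_iter (id_blinfun - x) n"])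
  have "continuous_on UNIV (\<lambda>x::'a oper. sqrt_iter (id_blinfun - x) n)" for n
    by (induction n)
      (auto intro!: continuous_intros bounded_bilinear.continuous_on [OF bounded_bilinear_blinfun_compose])
  then show "\<forall>\<^sub>F n in sequentially. continuous_on {x::'a oper. norm (id_blinfun - x) \<le> 1}
      (\<lambda>x. id_blinfun - sqrt_iter (id_blinfun - x) n)"
    by (intro always_eventually allI continuous_intros) (rule continuous_on_subset, auto)
  show "uniform_limit {x::'a oper. norm (id_blinfun - x) \<le> 1}
      (\<lambda>n x. id_blinfun - sqrt_iter (id_blinfun - x) n) sqrt_op sequentially"
    unfolding uniform_limit_sequentially_iff
  proof (intro allI impI)
    fix e :: real assume "0 < e"
    then obtain N where N: "\<And>n. n \<ge> N \<Longrightarrow> \<bar>sqrt_bound n - 1\<bar> < e"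
      using LIMSEQ_D [OF sqrt_bound_tendsto, of e] by auto
    have "dist (id_blinfun - sqrt_iter (id_blinfun - x) n) (sqrt_op x) < e"
      if n: "n \<ge> N" and x: "norm (id_blinfun - x) \<le> 1" for n and x :: "'a oper"
    proof -
      have "(\<lambda>k. norm (sqrt_iter (id_blinfun - x) (n + k) - sqrt_iter (id_blinfun - x) n)) \<longlonglongrightarrow>
          norm (lim (sqrt_iter (id_blinfun - x)) - sqrt_iter (id_blinfun - x) n)"
        using LIMSEQ_ignore_initial_segment [OF sqrt_iter_convergent [OF x], of n]
        by (intro tendsto_intros) (simp add: add.commute)
      moreover have "norm (sqrt_iter (id_blinfun - x) (n + k) - sqrt_iter (id_blinfun - x) n) \<le>
          1 - sqrt_bound n" for k
        using norm_sqrt_iter_diff [OF x, of n k] sqrt_bound_range [of "n + k"] by linarith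
      ultimately have "norm (lim (sqrt_iter (id_blinfun - x)) - sqrt_iter (id_blinfun - x) n) \<le> 1 - sqrt_bound n"
        by (intro LIMSEQ_le_const2) auto
      then show ?thesis
        using N [OF n] by (simp add: sqrt_op_def dist_norm)
    qed
    then show "\<exists>N. \<forall>n\<ge>N. \<forall>x\<in>{x::'a oper. norm (id_blinfun - x) \<le> 1}.
        dist (id_blinfun - sqrt_iter (id_blinfun - x) n) (sqrt_op x) < e"
      by blast
  qed
qed simp

section \<open>Projection operators and the sign of a self-adjoint operator\<close>

lemma orthogonal_component_unique:
  fixes K :: "'h::complex_hilbert_space set"
  assumes K: "closed_csubspace K" and "a \<in> K" "b \<in> K"
    and a: "\<And>k. k \<in> K \<Longrightarrow> cinner (x - a) k = 0" and b: "\<And>k. k \<in> K \<Longrightarrow> cinner (x - b) k = 0"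
  shows "a = b"
proof -
  have "a - b \<in> K"
    using closed_csubspace_diff [OF K] assms by blast
  then have "cinner ((x - b) - (x - a)) (a - b) = 0"
    using a b by (simp only: cinner_diff_left [of "x - b"]) simp
  then have "cinner (a - b) (a - b) = 0"
    by simp
  then show ?thesis
    by (simp add: cinner_self)
qed

lemma projection_operator:
  fixes K :: "'h::complex_hilbert_space set"
  assumes K: "closed_csubspace K"
  obtains P where "P \<in> bounded_ops" "\<And>x. P x \<in> K" "\<And>x k. k \<in> K \<Longrightarrow> cinner (x - P x) k = 0"
proof -
  obtain p where pK: "\<And>x. p x \<in> K" and orth: "\<And>x k. k \<in> K \<Longrightarrow> cinner (x - p x) k = 0"
    using orthogonal_projection_exists [OF K] by metis
  have eqI: "p x = a" if "a \<in> K" "\<And>k. k \<in> K \<Longrightarrow> cinner (x - a) k = 0" for x a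
    using orthogonal_component_unique [OF K pK that(1) orth that(2)] .
  have scaleC: "p (c *\<^sub>C x) = c *\<^sub>C p x" for c x
  proof (rule eqI)
    show "cinner (c *\<^sub>C x - c *\<^sub>C p x) k = 0" if "k \<in> K" for k
      using orth [OF that, of x] by (simp add: cinner_simps)
  qed (use K pK in \<open>auto simp: closed_csubspace_def\<close>)
  have "bounded_linear p"
  proof (rule bounded_linear_intro)
    show "p (x + y) = p x + p y" for x y
    proof (rule eqI)
      show "cinner (x + y - (p x + p y)) k = 0" if "k \<in> K" for k
        using orth [OF that, of x] orth [OF that, of y] by (simp add: cinner_simps)
    qed (use K pK in \<open>auto simp: closed_csubspace_def\<close>)
    show "p (r *\<^sub>R x) = r *\<^sub>R p x" for r x
      by (metis scaleC scaleC_of_real)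
    show "norm (p x) \<le> norm x * 1" for x
    proof (cases "p x = 0")
      case False
      have "cinner x (p x) = cinner (p x) (p x)"
        using orth [OF pK, of x x] by (simp add: cinner_simps)
      then have "cmod (cinner x (p x)) = norm (p x) * norm (p x)"
        by (simp add: cinner_self norm_mult power2_eq_square)
      then have "norm (p x) * norm (p x) \<le> norm x * norm (p x)"
        using Cauchy_Schwarz_cinner [of x "p x"] by simp
      then show ?thesis
        using False by simp
    qed simp
  qed
  then have "blinfun_apply (Blinfun p) = p"
    by (rule bounded_linear_Blinfun_apply)
  then show thesis
    using that [of "Blinfun p"] pK orth scaleC by (simp add: bounded_ops_def)
qed

text \<open>\<open>s\<close> is the symmetry that is \<open>1\<close> on the kernel of \<open>c - b\<close> and \<open>-1\<close> on its
  complement, where \<open>b = -c\<close>.\<close>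

lemma sign_exists:
  fixes b c :: "'h::complex_hilbert_space oper"
  assumes b: "b \<in> bounded_ops" "hadj b = b" and c: "c \<in> bounded_ops" "hadj c = c"
    and sq: "c o\<^sub>L c = b o\<^sub>L b" and bc: "b o\<^sub>L c = c o\<^sub>L b"
  obtains s where "s \<in> bounded_ops" "hadj s = s" "s o\<^sub>L s = id_blinfun" "s o\<^sub>L b = c"
    "\<And>T. \<lbrakk>T \<in> bounded_ops; T o\<^sub>L b = b o\<^sub>L T; hadj T o\<^sub>L b = b o\<^sub>L hadj T;
        T o\<^sub>L c = c o\<^sub>L T; hadj T o\<^sub>L c = c o\<^sub>L hadj T\<rbrakk> \<Longrightarrow> T o\<^sub>L s = s o\<^sub>L T"
proof -
  define K where "K = {x. c x = b x}"
  have "closed K"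
    unfolding K_def by (intro closed_Collect_eq continuous_intros)
  then have K: "closed_csubspace K"
    using b c by (simp add: closed_csubspace_def K_def blinfun.bilinear_simps bounded_opsD)
  obtain P where P: "P \<in> bounded_ops" "\<And>x. P x \<in> K" and orth: "\<And>x k. k \<in> K \<Longrightarrow> cinner (x - P x) k = 0"
    using projection_operator [OF K] by blast
  have PK: "P k = k" if "k \<in> K" for k
  proof (rule orthogonal_component_unique [OF K P(2) that])
    show "cinner (k - P k) l = 0" if "l \<in> K" for l
      using that by (rule orth)
  qed simp
  have "cinner (P x) y = cinner x (P y)" for x y
  proof -
    have "cinner (P x) (y - P y) = 0"
      using orth [OF P(2), of y x] by (metis cinner_commute complex_cnj_zero)
    then show ?thesis
      using orth [OF P(2), of x y] by (simp add: cinner_simps)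
  qed
  then have hadjP: "hadj P = P"
    by (rule hadj_eqI)
  \<comment> \<open>\<open>T\<close> maps \<open>K\<close> into itself, and so does
    \<open>hadj T\<close>; the latter makes \<open>T\<close> preserve the orthogonal complement as
    well.\<close>
  have comm: "T o\<^sub>L P = P o\<^sub>L T"
    if T: "T \<in> bounded_ops" "T o\<^sub>L b = b o\<^sub>L T" "hadj T o\<^sub>L b = b o\<^sub>L hadj T"
      "T o\<^sub>L c = c o\<^sub>L T" "hadj T o\<^sub>L c = c o\<^sub>L hadj T" for T
  proof (rule blinfun_eqI)
    fix x
    have app: "T (b x) = b (T x)" "hadj T (b x) = b (hadj T x)"
      "T (c x) = c (T x)" "hadj T (c x) = c (hadj T x)" for x
      using that by (metis blinfun_apply_blinfun_compose)+
    have "T (P x) = P (T x)"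
    proof (rule orthogonal_component_unique [OF K _ P(2) _ orth])
      show "T (P x) \<in> K"
        using P(2) [of x] by (simp add: K_def flip: app)
      fix k assume "k \<in> K"
      then have "hadj T k \<in> K"
        by (simp add: K_def flip: app)
      then have "cinner (x - P x) (hadj T k) = 0"
        by (rule orth)
      then show "cinner (T x - T (P x)) k = 0"
        by (simp add: cinner_hadj_right T blinfun.bilinear_simps)
    qed
    then show "(T o\<^sub>L P) x = (P o\<^sub>L T) x" by simp
  qed
  define s where "s = 2 *\<^sub>R P - id_blinfun"
  have s: "s \<in> bounded_ops" "hadj s = s"
    using P hadjP by (simp_all add: s_def bounded_ops_closure hadj_diff hadj_scaleR)
  have PP: "P o\<^sub>L P = P"
    by (rule blinfun_eqI) (simp add: PK P)
  have ss: "s o\<^sub>L s = id_blinfun"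
    by (simp add: s_def compose_simps PP scaleR_2)
  have scomm: "T o\<^sub>L s = s o\<^sub>L T" if "T o\<^sub>L P = P o\<^sub>L T" for T
    using that by (simp add: s_def compose_simps)
  have "s o\<^sub>L b = c"
  proof (rule blinfun_eqI)
    fix x
    have P: "c (P x) = b (P x)"
      using P(2) [of x] by (simp add: K_def)
    \<comment> \<open>From \<open>c^2 = b^2\<close> and \<open>b c = c b\<close> one gets
      \<open>(c - b) (c + b) = 0\<close>, so \<open>b + c\<close> maps everything into
      \<open>K\<close>. For \<open>y\<close> orthogonal to \<open>K\<close> and
      \<open>w = (b + c) y\<close>, self-adjointness then gives
      \<open><w, w> = <y, (b + c) w> = 0\<close>.\<close>
    have "b (x - P x) + c (x - P x) = 0"
    proof -
      define y where "y = x - P x"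
      define w where "w = b y + c y"
      have cb: "c (c z) = b (b z)" "c (b z) = b (c z)" for z
        using sq bc by (metis blinfun_apply_blinfun_compose)+
      have "b w + c w \<in> K"
        by (simp add: w_def K_def blinfun.bilinear_simps cb)
      then have "cinner y (b w + c w) = 0"
        unfolding y_def by (rule orth)
      then have "cinner w w = 0"
        using cinner_hadj_right [OF b(1), of y w] cinner_hadj_right [OF c(1), of y w] b c
        by (simp add: cinner_simps) (simp add: w_def cinner_simps add_ac)
      then show ?thesis
        by (simp add: cinner_self w_def y_def)
    qed
    then have "b (2 *\<^sub>R P x - x) = c x"
      using P by (simp add: blinfun.bilinear_simps scaleR_2 algebra_simps eq_neg_iff_add_eq_0)
    \<comment> \<open>The computation produced \<open>b (s x)\<close>; the order is exchanged by
      applying \<open>comm\<close> to \<open>b\<close> itself.\<close>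
    moreover have "s o\<^sub>L b = b o\<^sub>L s"
      using scomm comm [OF b(1)] b bc by metis
    ultimately show "(s o\<^sub>L b) x = c x"
      by (simp add: s_def blinfun.bilinear_simps)
  qed
  then show thesis
    using that [OF s ss] comm scomm by blast
qed

section \<open>Connectedness of the unitary group\<close>

lemma unitariesD:
  assumes "u \<in> unitaries M"
  shows "u \<in> M" "hadj u o\<^sub>L u = id_blinfun" "u o\<^sub>L hadj u = id_blinfun"
  using assms by (auto simp: unitaries_def)

lemma norm_unitary:
  assumes "u \<in> bounded_ops" "hadj u o\<^sub>L u = id_blinfun"
  shows "norm (u x) = norm x"
proof -
  have "complex_of_real ((norm x)\<^sup>2) = of_real ((norm (u x))\<^sup>2)"
    using cinner_hadj_compose_self [OF assms(1), of x] unfolding assms(2) cinner_self [symmetric] by simp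
  then show ?thesis
    unfolding of_real_eq_iff by simp
qed

lemma norm_unitary_le:
  assumes "u \<in> bounded_ops" "hadj u o\<^sub>L u = id_blinfun"
  shows "norm u \<le> 1"
  using norm_unitary [OF assms] by (intro norm_blinfun_bound) simp_all

lemma scalar_op_ii_square: "scalar_op \<i> o\<^sub>L scalar_op \<i> = - id_blinfun"
  using scalar_op_of_real [of "-1"] by (simp add: scalar_op_compose)

lemma scalar_op_ii_cancel: "scalar_op \<i> o\<^sub>L (scalar_op \<i> o\<^sub>L x) = - x"
  by (simp add: scalar_op_ii_square compose_simps flip: compose_assoc)

lemma hadj_scalar_op_ii: "hadj (scalar_op \<i>) = - scalar_op \<i>"
proof -
  have "hadj (scalar_op \<i>) = scalar_op (of_real (-1)) o\<^sub>L scalar_op \<i>"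
    unfolding hadj_scalar_op scalar_op_compose by simp
  then show ?thesis
    unfolding scalar_op_of_real by (simp add: compose_simps)
qed

lemma scalar_op_left_commute:
  "x \<in> bounded_ops \<Longrightarrow> x o\<^sub>L (scalar_op c o\<^sub>L y) = scalar_op c o\<^sub>L (x o\<^sub>L y)"
  by (metis compose_assoc scalar_op_commute)

lemmas scalar_op_ii_simps = scalar_op_ii_cancel scalar_op_commute scalar_op_left_commute

text \<open>The reason why both paths in \<open>connected_unitaries\<close> stay among the
  unitaries: \<open>(p - i q) (p + i q) = p^2 + q^2\<close> for commuting self-adjoint
  \<open>p\<close> and \<open>q\<close>.\<close>

lemma unitary_from_parts:
  assumes M: "von_neumann_algebra M" and p: "p \<in> M" "hadj p = p" and q: "q \<in> M" "hadj q = q"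
    and pq: "p o\<^sub>L q = q o\<^sub>L p" and sum: "(p o\<^sub>L p) + (q o\<^sub>L q) = id_blinfun"
  shows "p + (scalar_op \<i> o\<^sub>L q) \<in> unitaries M"
proof -
  let ?J = "scalar_op \<i> :: 'a oper"
  note cl = von_neumann_algebra_closure [OF M]
  have u: "p + (?J o\<^sub>L q) \<in> M"
    by (intro cl p q)
  have h: "hadj (p + (?J o\<^sub>L q)) = p - (?J o\<^sub>L q)"
    using p q cl by (simp add: hadj_add hadj_compose hadj_scalar_op_ii bounded_ops_closure
        scalar_op_commute compose_simps)
  show ?thesis
    unfolding unitaries_def mem_Collect_eq h
    using u p q sum cl by (simp add: compose_simps compose_assoc scalar_op_ii_simps pq add.commute)
qed

lemma connected_component_path:
  assumes "continuous_on {0..t} \<gamma>" "0 \<le> t" "\<And>r. 0 \<le> r \<Longrightarrow> r \<le> t \<Longrightarrow> \<gamma> r \<in> S"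
  shows "connected_component S (\<gamma> 0) (\<gamma> (t::real))"
  unfolding connected_component_def
  using assms by (intro exI [of _ "\<gamma> ` {0..t}"] conjI connected_continuous_image) auto

text \<open>For \<open>u = a + ib\<close> let \<open>s\<close> be a symmetry with \<open>sb = \<bar>b\<bar> = \<surd>(1 - a\<^sup>2)\<close>.  The paths
  \<open>ta + is\<surd>(1 - t\<^sup>2a\<^sup>2)\<close> and \<open>cos \<theta> + is sin \<theta>\<close> join \<open>u\<close> to \<open>is\<close> and \<open>is\<close> to \<open>1\<close>.\<close>

theorem connected_unitaries:
  assumes M: "von_neumann_algebra M"
  shows "connected (unitaries M)"
proof -
  note cl = von_neumann_algebra_closure [OF M]
  let ?J = "scalar_op \<i> :: 'a oper"
  have "connected_component (unitaries M) id_blinfun u" if u: "u \<in> unitaries M" for u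
  proof -
    note uD = unitariesD [OF u]
    have uM: "u \<in> M" "hadj u \<in> M" "u \<in> bounded_ops" "hadj u \<in> bounded_ops"
      using uD cl by auto
    define a where "a = (1/2) *\<^sub>R (u + hadj u)"
    define b where "b = (1/2) *\<^sub>R (scalar_op \<i> o\<^sub>L (hadj u - u))"
    have aM: "a \<in> M" and bM: "b \<in> M"
      unfolding a_def b_def by (intro cl uM)+
    have ab: "a \<in> bounded_ops" and bb: "b \<in> bounded_ops"
      using aM bM cl by auto
    have ha: "hadj a = a"
      using uM by (simp add: a_def hadj_scaleR hadj_add hadj_hadj bounded_ops_closure add.commute)
    have hb: "hadj b = b"
      using uM by (simp add: b_def hadj_scaleR hadj_compose hadj_diff hadj_hadj bounded_ops_closure
          hadj_scalar_op_ii scalar_op_commute compose_simps)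
    have comab: "a o\<^sub>L b = b o\<^sub>L a"
      using uM uD by (simp add: a_def b_def compose_simps compose_assoc scalar_op_ii_simps
          bounded_ops_closure scaleR_add_right scaleR_diff_right)
    have sumab: "(a o\<^sub>L a) + (b o\<^sub>L b) = id_blinfun"
    proof -
      have "(1/4) *\<^sub>R id_blinfun + ((1/4) *\<^sub>R id_blinfun + ((1/4) *\<^sub>R id_blinfun +
          (1/4) *\<^sub>R id_blinfun)) = (id_blinfun :: 'a oper)"
        by (simp flip: scaleR_add_left)
      then show ?thesis
        using uM uD by (simp add: a_def b_def compose_simps compose_assoc scalar_op_ii_simps
            scalar_op_ii_square algebra_simps)
    qed
    have uab: "u = a + (?J o\<^sub>L b)"
      by (simp add: a_def b_def compose_simps scalar_op_ii_cancel algebra_simps flip: scaleR_2 scaleR_add_left)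
    have norm_a: "norm a \<le> 1"
      using norm_unitary_le [OF uM(3) uD(2)] norm_hadj_le [OF uM(3)] norm_triangle_ineq [of u "hadj u"]
      by (simp add: a_def)
    \<comment> \<open>The square that the imaginary part must have when the real part is
      \<open>t a\<close>. For \<open>t\<close> in the unit interval its distance from the identity
      is at most 1, the range of \<open>sqrt_op\<close>.\<close>
    define x where "x t = id_blinfun - t\<^sup>2 *\<^sub>R (a o\<^sub>L a)" for t
    have norm_x: "norm (id_blinfun - x t) \<le> 1" if "0 \<le> t" "t \<le> 1" for t
    proof -
      have "norm (a o\<^sub>L a) \<le> 1"
        using norm_blinfun_compose [of a a] norm_a by (meson mult_le_one norm_ge_zero order_trans)
      moreover have "t\<^sup>2 \<le> 1"
        using that by (simp add: power_le_one)
      ultimately show ?thesis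
        by (simp add: x_def mult_le_one)
    qed
    define c where "c t = sqrt_op (x t)" for t
    have xM: "x t \<in> M" for t
      unfolding x_def by (intro cl aM)
    have hx: "hadj (x t) = x t" for t
      using ab by (simp add: x_def hadj_diff hadj_scaleR hadj_compose bounded_ops_closure ha)
    have cM: "c t \<in> M" and hc: "hadj (c t) = c t" and cc: "c t o\<^sub>L c t = x t"
      if "0 \<le> t" "t \<le> 1" for t
      unfolding c_def using norm_x [OF that] xM hx cl
      by (auto intro: sqrt_op_vna [OF M] hadj_sqrt_op sqrt_op_square)
    have c_comm: "T o\<^sub>L c t = c t o\<^sub>L T" if "T o\<^sub>L a = a o\<^sub>L T" "0 \<le> t" "t \<le> 1" for T t
    proof -
      have "T o\<^sub>L (a o\<^sub>L a) = (a o\<^sub>L a) o\<^sub>L T"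
        using that by (metis compose_assoc)
      then have "T o\<^sub>L x t = x t o\<^sub>L T"
        by (simp add: x_def compose_simps)
      then show ?thesis
        unfolding c_def using sqrt_op_commute norm_x that by blast
    qed
    \<comment> \<open>The root \<open>c 1\<close> of this square commutes with \<open>b\<close>
      because \<open>b\<close> commutes with \<open>a\<close>; thus \<open>b\<close> and
      \<open>c 1\<close> satisfy the assumptions of \<open>sign_exists\<close>.\<close>
    have "b o\<^sub>L b = x 1"
      using sumab by (simp add: x_def eq_diff_eq add.commute)
    then have c1: "c 1 \<in> M" "c 1 \<in> bounded_ops" "hadj (c 1) = c 1" "c 1 o\<^sub>L c 1 = b o\<^sub>L b" "b o\<^sub>L c 1 = c 1 o\<^sub>L b"
      using cM [of 1] hc [of 1] cc [of 1] c_comm [of b 1] cl comab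
      by auto
    obtain s where s: "s \<in> bounded_ops" "hadj s = s" "s o\<^sub>L s = id_blinfun" "s o\<^sub>L b = c 1"
      and s_comm: "\<And>T. \<lbrakk>T \<in> bounded_ops; T o\<^sub>L b = b o\<^sub>L T; hadj T o\<^sub>L b = b o\<^sub>L hadj T;
        T o\<^sub>L c 1 = c 1 o\<^sub>L T; hadj T o\<^sub>L c 1 = c 1 o\<^sub>L hadj T\<rbrakk> \<Longrightarrow> T o\<^sub>L s = s o\<^sub>L T"
      using sign_exists [OF bb hb c1(2,3,4,5)] by blast
    have sM: "s \<in> M"
    proof -
      have "T o\<^sub>L s = s o\<^sub>L T" if T: "T \<in> commutant M" for T
        using T hadj_commutant [OF M T] bM c1(1)
        by (intro s_comm) (auto simp: commutant_def)
      then have "s \<in> commutant (commutant M)"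
        using s(1) by (auto simp: commutant_def)
      then show ?thesis
        using M by (simp add: von_neumann_algebra_def)
    qed
    have sa: "a o\<^sub>L s = s o\<^sub>L a"
      using comab ha c_comm [of a 1] by (intro s_comm ab) auto
    have sc: "s o\<^sub>L c t = c t o\<^sub>L s" if "0 \<le> t" "t \<le> 1" for t
      using c_comm sa that by simp
    define \<gamma> where "\<gamma> = (\<lambda>t. t *\<^sub>R a + (?J o\<^sub>L (s o\<^sub>L c t)))"
    define \<delta> where "\<delta> = (\<lambda>t. cos t *\<^sub>R id_blinfun + (?J o\<^sub>L (sin t *\<^sub>R s)))"
    have "connected_component (unitaries M) (\<gamma> 0) (\<gamma> 1)"
    proof (rule connected_component_path)
      have "continuous_on {0..1} c"
        unfolding c_def
        by (rule continuous_on_compose2 [OF continuous_on_sqrt_op])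
          (use norm_x in \<open>auto simp: x_def intro!: continuous_intros\<close>)
      from bounded_bilinear.continuous_on [OF bounded_bilinear_blinfun_compose continuous_on_const
          bounded_bilinear.continuous_on [OF bounded_bilinear_blinfun_compose continuous_on_const this]]
      have "continuous_on {0..1} (\<lambda>t. ?J o\<^sub>L (s o\<^sub>L c t))" .
      from continuous_on_add [OF continuous_on_scaleR [OF continuous_on_id continuous_on_const] this]
      have "continuous_on {0..1} (\<lambda>t. t *\<^sub>R a + (?J o\<^sub>L (s o\<^sub>L c t)))" .
      then show "continuous_on {0..1} \<gamma>"
        by (simp only: \<gamma>_def)
      show "\<gamma> t \<in> unitaries M" if t: "0 \<le> t" "t \<le> 1" for t
        unfolding \<gamma>_def
      proof (rule unitary_from_parts [OF M])
        have cb: "c t \<in> bounded_ops"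
          by (rule cl(7) [OF cM [OF t]])
        show "t *\<^sub>R a \<in> M" "s o\<^sub>L c t \<in> M"
          by (intro cl cM [OF t] aM sM)+
        show "hadj (t *\<^sub>R a) = t *\<^sub>R a"
          by (simp add: hadj_scaleR ab ha)
        show "hadj (s o\<^sub>L c t) = s o\<^sub>L c t"
          using cb s by (simp add: hadj_compose hc t sc)
        show "t *\<^sub>R a o\<^sub>L (s o\<^sub>L c t) = s o\<^sub>L c t o\<^sub>L t *\<^sub>R a"
          using sa c_comm [of a t] t by (simp add: compose_simps) (metis compose_assoc)
        have "(s o\<^sub>L c t) o\<^sub>L (s o\<^sub>L c t) = x t"
          using cc [OF t] sc [OF t] s(3) by (metis compose_assoc compose_id(2))
        then show "(t *\<^sub>R a o\<^sub>L t *\<^sub>R a) + ((s o\<^sub>L c t) o\<^sub>L (s o\<^sub>L c t)) = id_blinfun"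
          by (simp add: compose_simps x_def power2_eq_square)
      qed
    qed simp
    moreover have "\<gamma> 1 = u"
    proof -
      have "s o\<^sub>L c 1 = b"
        by (simp add: s(3) flip: s(4) compose_assoc)
      then show ?thesis
        using uab by (simp add: \<gamma>_def)
    qed
    moreover have "\<gamma> 0 = ?J o\<^sub>L s"
      by (simp add: \<gamma>_def c_def x_def)
    moreover have "connected_component (unitaries M) (\<delta> 0) (\<delta> (pi/2))"
    proof (rule connected_component_path)
      show "continuous_on {0..pi/2} \<delta>"
        unfolding \<delta>_def
        by (intro continuous_on_add continuous_on_scaleR continuous_on_cos continuous_on_sin
            continuous_on_id continuous_on_const
            bounded_bilinear.continuous_on [OF bounded_bilinear_blinfun_compose])
      show "\<delta> t \<in> unitaries M" for t
        unfolding \<delta>_def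
        by (rule unitary_from_parts [OF M])
          (use s sM in \<open>auto simp: cl hadj_scaleR bounded_ops_closure compose_simps
             simp flip: power2_eq_square scaleR_add_left\<close>)
    qed simp
    moreover have "\<delta> 0 = id_blinfun" "\<delta> (pi/2) = ?J o\<^sub>L s"
      by (simp_all add: \<delta>_def)
    ultimately show ?thesis
      by (auto intro: connected_component_trans)
  qed
  then show ?thesis
    unfolding connected_iff_connected_component
    by (meson connected_component_sym connected_component_trans)
qed

section \<open>Quotients of groups with a bi-invariant metric\<close>

no_notation subset_mset (infix \<open><#\<close> 50)

lemma continuous_map_quotient_topology:
  "continuous_map X (quotient_topology X f) f"
  by (auto simp: continuous_map_def topspace_quotient_topology openin_quotient_topology)

lemma continuous_map_from_quotient_topology:
  assumes "continuous_map X Y (g \<circ> f)"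
  shows "continuous_map (quotient_topology X f) Y g"
  unfolding continuous_map_def
proof (intro conjI allI impI)
  show "g \<in> topspace (quotient_topology X f) \<rightarrow> topspace Y"
    using assms by (auto simp: topspace_quotient_topology continuous_map_def)
  fix V assume "openin Y V"
  then have "openin X {x \<in> topspace X. (g \<circ> f) x \<in> V}"
    using assms by (simp add: continuous_map_def)
  moreover have "{x \<in> topspace X. f x \<in> {y \<in> topspace (quotient_topology X f). g y \<in> V}} =
      {x \<in> topspace X. (g \<circ> f) x \<in> V}"
    by (auto simp: topspace_quotient_topology)
  ultimately show "openin (quotient_topology X f) {y \<in> topspace (quotient_topology X f). g y \<in> V}"
    by (auto simp: openin_quotient_topology topspace_quotient_topology)
qed

text \<open>Near any point \<open>f\<close> and \<open>g\<close> each stay in one sheet. In a common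
  sheet injectivity of \<open>p\<close> forces agreement nearby, in different sheets disjointness
  forces disagreement; so the sets of agreement and disagreement are both open.\<close>

lemma covering_map_lift_unique:
  assumes p: "covering_map X Y p" and Z: "connected_space Z"
    and f: "continuous_map Z X f" and g: "continuous_map Z X g"
    and fg: "\<And>z. z \<in> topspace Z \<Longrightarrow> p (f z) = p (g z)"
    and a: "a \<in> topspace Z" "f a = g a" and z: "z \<in> topspace Z"
  shows "f z = g z"
proof -
  define A where "A = {z \<in> topspace Z. f z = g z}"
  define B where "B = {z \<in> topspace Z. f z \<noteq> g z}"
  have nbhd: "\<exists>W. openin Z W \<and> z \<in> W \<and> (W \<subseteq> A \<or> W \<subseteq> B)" if z: "z \<in> topspace Z" for z
  proof -
    have fz: "f z \<in> topspace X" and gz: "g z \<in> topspace X"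
      using f g z by (auto simp: continuous_map_def)
    then have "p (f z) \<in> topspace Y"
      using p by (auto simp: covering_map_def)
    then obtain T \<V> where T: "p (f z) \<in> T" and cover: "\<Union>\<V> = topspace X \<inter> p -` T"
      and open\<V>: "\<And>U. U \<in> \<V> \<Longrightarrow> openin X U" and disj: "pairwise disjnt \<V>"
      and homeo: "\<And>U. U \<in> \<V> \<Longrightarrow> homeomorphic_map (subtopology X U) (subtopology Y T) p"
      using p unfolding covering_map_def by metis
    have inj: "inj_on p U" if "U \<in> \<V>" for U
    proof -
      have "topspace (subtopology X U) = U"
        using openin_subset [OF open\<V> [OF that]] by auto
      then show ?thesis
        using homeomorphic_imp_injective_map [OF homeo [OF that]] by simp
    qed
    obtain U where U: "U \<in> \<V>" "f z \<in> U"
      using cover fz T by blast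
    obtain V where V: "V \<in> \<V>" "g z \<in> V"
      using cover gz T fg [OF z] by (metis IntI UnionE vimageI)
    define W where "W = {z \<in> topspace Z. f z \<in> U} \<inter> {z \<in> topspace Z. g z \<in> V}"
    have "openin Z W"
      unfolding W_def using f g open\<V> U V by (intro openin_Int) (auto simp: continuous_map_def)
    moreover have "z \<in> W"
      using z U V by (simp add: W_def)
    moreover have "W \<subseteq> A \<or> W \<subseteq> B"
    proof (cases "U = V")
      case True
      then have "W \<subseteq> A"
        using inj [OF U(1)] fg by (auto simp: W_def A_def inj_on_def)
      then show ?thesis ..
    next
      case False
      then have "disjnt U V"
        using disj U V by (simp add: pairwise_def)
      then have "W \<subseteq> B"
        by (auto simp: W_def B_def disjnt_def)
      then show ?thesis ..
    qed
    ultimately show ?thesis by blast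
  qed
  have disj: "A \<inter> B = {}" and un: "A \<union> B = topspace Z"
    by (auto simp: A_def B_def)
  have "\<exists>W. openin Z W \<and> z \<in> W \<and> W \<subseteq> A" if "z \<in> A" for z
    using nbhd [of z] un disj that by blast
  then have "openin Z A"
    using openin_subopen by blast
  moreover have "\<exists>W. openin Z W \<and> z \<in> W \<and> W \<subseteq> B" if "z \<in> B" for z
    using nbhd [of z] un disj that by blast
  then have "openin Z B"
    using openin_subopen by blast
  moreover have "a \<in> A"
    using a by (simp add: A_def)
  ultimately have "B = {}"
    using Z disj un unfolding connected_space_def by (metis empty_iff order_refl)
  then show ?thesis
    using z by (auto simp: B_def)
qed

text \<open>Abstracts \<open>unitary_group M\<close> with its normalizer \<open>K\<close>, the
  subgroup \<open>H\<close> and the orbit map \<open>f\<close>. By \<open>fiber\<close> the fibres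
  of \<open>f\<close> are the left cosets of \<open>K\<close>, and \<open>near\<close> makes
  \<open>H\<close> open in \<open>K\<close> with an explicit radius, which bi-invariance carries to
  every point.\<close>

locale bi_invariant_quotient = group G
  for G :: "('a::metric_space, 'm) monoid_scheme" (structure) +
  fixes K H :: "'a set" and f :: "'a \<Rightarrow> 'b" and \<epsilon> :: real
  assumes dist_left: "\<lbrakk>x \<in> carrier G; y \<in> carrier G; z \<in> carrier G\<rbrakk> \<Longrightarrow> dist (z \<otimes> x) (z \<otimes> y) = dist x y"
    and dist_right: "\<lbrakk>x \<in> carrier G; y \<in> carrier G; z \<in> carrier G\<rbrakk> \<Longrightarrow> dist (x \<otimes> z) (y \<otimes> z) = dist x y"
    and connected_carrier: "connected (carrier G)"
    and subgroup_K: "subgroup K G"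
    and normal_H: "H \<lhd> G\<lparr>carrier := K\<rparr>"
    and fiber: "\<lbrakk>x \<in> carrier G; y \<in> carrier G\<rbrakk> \<Longrightarrow> f x = f y \<longleftrightarrow> inv x \<otimes> y \<in> K"
    and pos: "0 < \<epsilon>"
    and near: "\<lbrakk>x \<in> K; dist x \<one> < \<epsilon>\<rbrakk> \<Longrightarrow> x \<in> H"
begin

abbreviation "X \<equiv> quotient_topology (top_of_set (carrier G)) (\<lambda>x. x <# H)"
abbreviation "Y \<equiv> quotient_topology (top_of_set (carrier G)) f"
abbreviation "W \<equiv> G\<lparr>carrier := K\<rparr> Mod H"

text \<open>The restriction to \<open>topspace X\<close> is there because the elements of
  \<open>Bij\<close> are extensional functions.\<close>

definition act :: "'a set \<Rightarrow> 'a set \<Rightarrow> 'a set" where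
  "act C = (\<lambda>A\<in>topspace X. A <#> C)"

text \<open>The representative of the coset is arbitrary; \<open>\<Phi>_coset\<close> shows that the
  choice does not matter, because \<open>H\<close> lies in \<open>K\<close>.\<close>

definition \<Phi> :: "'a set \<Rightarrow> 'b" where
  "\<Phi> A = f (SOME x. x \<in> carrier G \<and> A = x <# H)"

lemma cancel [simp]:
  assumes "x \<in> carrier G" "y \<in> carrier G"
  shows "inv x \<otimes> (x \<otimes> y) = y" "x \<otimes> (inv x \<otimes> y) = y"
  using assms m_assoc [of "inv x" x y] m_assoc [of x "inv x" y] by simp_all

lemma K_carrier: "x \<in> K \<Longrightarrow> x \<in> carrier G"
  using subgroup.mem_carrier [OF subgroup_K] .

lemma subgroup_H: "subgroup H G"
  using incl_subgroup [OF subgroup_K] normal_imp_subgroup [OF normal_H] by blast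

lemma H_carrier: "x \<in> H \<Longrightarrow> x \<in> carrier G"
  using subgroup.mem_carrier [OF subgroup_H] .

lemma H_K: "x \<in> H \<Longrightarrow> x \<in> K"
  using subgroup.subset [OF normal_imp_subgroup [OF normal_H]] by auto

lemmas one_mem = subgroup.one_closed [OF subgroup_H] subgroup.one_closed [OF subgroup_K]
lemmas mult_mem = subgroup.m_closed [OF subgroup_H] subgroup.m_closed [OF subgroup_K]
lemmas inv_mem = subgroup.m_inv_closed [OF subgroup_H] subgroup.m_inv_closed [OF subgroup_K]

lemma conj_mem: "\<lbrakk>w \<in> K; h \<in> H\<rbrakk> \<Longrightarrow> inv w \<otimes> h \<otimes> w \<in> H"
  using normal.inv_op_closed1 [OF normal_H, of w h] m_inv_consistent [OF subgroup_K] by simp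

lemma coset_eq_iff:
  assumes "x \<in> carrier G" "y \<in> carrier G"
  shows "x <# H = y <# H \<longleftrightarrow> inv x \<otimes> y \<in> H"
proof
  assume "x <# H = y <# H"
  then have "y \<in> x <# H"
    using one_mem assms by (force simp: l_coset_def)
  then obtain h where "h \<in> H" "y = x \<otimes> h"
    by (auto simp: l_coset_def)
  then show "inv x \<otimes> y \<in> H"
    using assms H_carrier by (simp add: inv_solve_left')
next
  assume h: "inv x \<otimes> y \<in> H"
  define h where "h = inv x \<otimes> y"
  have hH: "h \<in> H" and y: "y = x \<otimes> h"
    using h assms by (simp_all add: h_def inv_solve_left')
  show "x <# H = y <# H"
  proof
    have "x \<otimes> k \<in> y <# H" if "k \<in> H" for k
      unfolding l_coset_def using that hH assms mult_mem(1) inv_mem(1)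
      by (auto simp: y H_carrier m_assoc intro!: bexI [of _ "inv h \<otimes> k"])
    then show "x <# H \<subseteq> y <# H"
      by (auto simp: l_coset_def)
    have "y \<otimes> k \<in> x <# H" if "k \<in> H" for k
      unfolding l_coset_def using that hH assms mult_mem(1)
      by (auto simp: y H_carrier m_assoc intro!: bexI [of _ "h \<otimes> k"])
    then show "y <# H \<subseteq> x <# H"
      by (auto simp: l_coset_def)
  qed
qed

lemma topspace_X: "topspace X = (\<lambda>x. x <# H) ` carrier G"
  by (simp add: topspace_quotient_topology)

lemma topspace_Y: "topspace Y = f ` carrier G"
  by (simp add: topspace_quotient_topology)

lemma \<Phi>_coset:
  assumes "x \<in> carrier G"
  shows "\<Phi> (x <# H) = f x"
proof -
  define y where "y = (SOME y. y \<in> carrier G \<and> x <# H = y <# H)"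
  have "y \<in> carrier G \<and> x <# H = y <# H"
    unfolding y_def by (rule someI_ex [of "\<lambda>y. y \<in> carrier G \<and> x <# H = y <# H"]) (use assms in blast)
  then have "f x = f y"
    using assms coset_eq_iff [of x y] fiber [of x y] H_K by auto
  then show ?thesis
    by (simp add: \<Phi>_def y_def)
qed

text \<open>The factor group is built from right cosets and the space from left cosets; inside
  \<open>K\<close> they coincide by normality.\<close>

lemma r_coset_eq_l_coset:
  assumes "w \<in> K" shows "H #> w = w <# H"
  using normal.coset_eq [OF normal_H] assms by (simp add: r_coset_def l_coset_def)

text \<open>Moving \<open>h\<close> past \<open>w\<close> turns it into
  \<open>inv w \<otimes> h \<otimes> w\<close>, which stays in \<open>H\<close> because
  \<open>w\<close> lies in \<open>K\<close>; \<open>x\<close> may be any element of the group, so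
  products of cosets describe the right action.\<close>

lemma coset_mult_coset:
  assumes "x \<in> carrier G" "w \<in> K"
  shows "(x <# H) <#> (w <# H) = (x \<otimes> w) <# H"
proof
  show "(x <# H) <#> (w <# H) \<subseteq> (x \<otimes> w) <# H"
  proof
    fix z assume "z \<in> (x <# H) <#> (w <# H)"
    then obtain h k where hk: "h \<in> H" "k \<in> H" "z = (x \<otimes> h) \<otimes> (w \<otimes> k)"
      by (auto simp: l_coset_def set_mult_def)
    then have "z = (x \<otimes> w) \<otimes> ((inv w \<otimes> h \<otimes> w) \<otimes> k)"
      using assms by (simp add: K_carrier H_carrier m_assoc)
    then show "z \<in> (x \<otimes> w) <# H"
      using hk conj_mem [OF assms(2)] mult_mem(1) unfolding l_coset_def by blast
  qed
  show "(x \<otimes> w) <# H \<subseteq> (x <# H) <#> (w <# H)"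
  proof
    fix z assume "z \<in> (x \<otimes> w) <# H"
    then obtain k where "k \<in> H" "z = (x \<otimes> \<one>) \<otimes> (w \<otimes> k)"
      using assms by (auto simp: l_coset_def K_carrier H_carrier m_assoc)
    then show "z \<in> (x <# H) <#> (w <# H)"
      using one_mem(1) unfolding l_coset_def set_mult_def by blast
  qed
qed

lemma carrier_W: "carrier W = (\<lambda>w. w <# H) ` K"
proof -
  have "carrier W = (\<lambda>w. H #> w) ` K"
    by (auto simp: FactGroup_def RCOSETS_def r_coset_def)
  then show ?thesis
    using r_coset_eq_l_coset by simp
qed

lemma group_W: "group W"
  using normal.factorgroup_is_group [OF normal_H] .

lemma mult_W: "C \<otimes>\<^bsub>W\<^esub> D = C <#> D"
  by (simp add: set_mult_def)

lemma one_W: "\<one>\<^bsub>W\<^esub> = \<one> <# H"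
  using H_carrier by (auto simp: l_coset_def)

lemma inv_W:
  assumes "w \<in> K" shows "inv\<^bsub>W\<^esub> (w <# H) = inv w <# H"
proof (rule group.inv_equality [OF group_W])
  show "(inv w <# H) \<otimes>\<^bsub>W\<^esub> (w <# H) = \<one>\<^bsub>W\<^esub>"
    unfolding mult_W one_W using assms by (simp add: coset_mult_coset K_carrier)
qed (use assms inv_mem in \<open>auto simp: carrier_W\<close>)

section \<open>Open quotient maps and evenly covered sets\<close>

lemma openin_translate:
  assumes U: "openin (top_of_set (carrier G)) U" and w: "w \<in> carrier G"
  shows "openin (top_of_set (carrier G)) ((\<lambda>x. x \<otimes> w) ` U)"
  unfolding openin_euclidean_subtopology_iff
proof (intro conjI ballI)
  show "(\<lambda>x. x \<otimes> w) ` U \<subseteq> carrier G"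
    using assms openin_imp_subset by fastforce
  fix y assume "y \<in> (\<lambda>x. x \<otimes> w) ` U"
  then obtain x where x: "x \<in> U" "y = x \<otimes> w" by blast
  then obtain e where e: "e > 0" "\<And>z. z \<in> carrier G \<Longrightarrow> dist z x < e \<Longrightarrow> z \<in> U"
    using U unfolding openin_euclidean_subtopology_iff by blast
  have xG: "x \<in> carrier G"
    using x U openin_imp_subset by blast
  have "z \<in> (\<lambda>x. x \<otimes> w) ` U" if z: "z \<in> carrier G" "dist z y < e" for z
  proof
    show "z = z \<otimes> inv w \<otimes> w"
      using z w by (simp add: m_assoc)
    have "dist (z \<otimes> inv w) x = dist (z \<otimes> inv w \<otimes> w) (x \<otimes> w)"
      using z w xG by (simp add: dist_right)
    also have "\<dots> = dist z y"
      using z w x by (simp add: m_assoc)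
    finally show "z \<otimes> inv w \<in> U"
      using z w e by simp
  qed
  then show "\<exists>e>0. \<forall>z\<in>carrier G. dist z y < e \<longrightarrow> z \<in> (\<lambda>x. x \<otimes> w) ` U"
    using e by blast
qed

text \<open>For \<open>S = H\<close> and \<open>S = K\<close> this set is the saturation of
  \<open>U\<close> for the two quotient maps, so both of them are open.\<close>

lemma openin_Union_translates:
  assumes U: "openin (top_of_set (carrier G)) U" and "S \<subseteq> carrier G"
  shows "openin (top_of_set (carrier G)) {x \<in> carrier G. \<exists>s\<in>S. \<exists>u\<in>U. x = u \<otimes> s}"
proof -
  have "openin (top_of_set (carrier G)) (\<Union>s\<in>S. (\<lambda>x. x \<otimes> s) ` U)"
    using openin_translate assms by (intro openin_Union) auto
  moreover have "(\<Union>s\<in>S. (\<lambda>x. x \<otimes> s) ` U) = {x \<in> carrier G. \<exists>s\<in>S. \<exists>u\<in>U. x = u \<otimes> s}"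
    using assms openin_imp_subset [OF U] by auto
  ultimately show ?thesis by simp
qed

lemma openin_X_image:
  assumes U: "openin (top_of_set (carrier G)) U"
  shows "openin X ((\<lambda>x. x <# H) ` U)"
proof -
  have sub: "U \<subseteq> carrier G"
    using U openin_imp_subset by blast
  have "{x \<in> carrier G. x <# H \<in> (\<lambda>x. x <# H) ` U} = {x \<in> carrier G. \<exists>s\<in>H. \<exists>u\<in>U. x = u \<otimes> s}"
  proof (intro Collect_cong conj_cong refl)
    fix x assume x: "x \<in> carrier G"
    have "x <# H = u <# H \<longleftrightarrow> inv u \<otimes> x \<in> H" if "u \<in> U" for u
      using coset_eq_iff [of u x] x sub that by auto
    then have "x <# H \<in> (\<lambda>x. x <# H) ` U \<longleftrightarrow> (\<exists>u\<in>U. inv u \<otimes> x \<in> H)"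
      unfolding image_iff by (intro bex_cong refl)
    also have "\<dots> \<longleftrightarrow> (\<exists>u\<in>U. \<exists>s\<in>H. x = u \<otimes> s)"
    proof (intro bex_cong refl)
      fix u assume "u \<in> U"
      then show "inv u \<otimes> x \<in> H \<longleftrightarrow> (\<exists>s\<in>H. x = u \<otimes> s)"
        using x sub H_carrier by (auto intro!: bexI [of _ "inv u \<otimes> x"])
    qed
    also have "\<dots> \<longleftrightarrow> (\<exists>s\<in>H. \<exists>u\<in>U. x = u \<otimes> s)"
      by blast
    finally show "x <# H \<in> (\<lambda>x. x <# H) ` U \<longleftrightarrow> (\<exists>s\<in>H. \<exists>u\<in>U. x = u \<otimes> s)" .
  qed
  then show ?thesis
    using openin_Union_translates [OF U subgroup.subset [OF subgroup_H]] sub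
    by (auto simp: openin_quotient_topology)
qed

lemma openin_Y_image:
  assumes U: "openin (top_of_set (carrier G)) U"
  shows "openin Y (f ` U)"
proof -
  have sub: "U \<subseteq> carrier G"
    using U openin_imp_subset by blast
  have "{x \<in> carrier G. f x \<in> f ` U} = {x \<in> carrier G. \<exists>s\<in>K. \<exists>u\<in>U. x = u \<otimes> s}"
  proof (intro Collect_cong conj_cong refl)
    fix x assume x: "x \<in> carrier G"
    have "f x = f u \<longleftrightarrow> inv u \<otimes> x \<in> K" if "u \<in> U" for u
      using fiber [of u x] x sub that by auto
    then have "f x \<in> f ` U \<longleftrightarrow> (\<exists>u\<in>U. inv u \<otimes> x \<in> K)"
      unfolding image_iff by (intro bex_cong refl)
    also have "\<dots> \<longleftrightarrow> (\<exists>u\<in>U. \<exists>s\<in>K. x = u \<otimes> s)"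
    proof (intro bex_cong refl)
      fix u assume "u \<in> U"
      then show "inv u \<otimes> x \<in> K \<longleftrightarrow> (\<exists>s\<in>K. x = u \<otimes> s)"
        using x sub K_carrier by (auto intro!: bexI [of _ "inv u \<otimes> x"])
    qed
    also have "\<dots> \<longleftrightarrow> (\<exists>s\<in>K. \<exists>u\<in>U. x = u \<otimes> s)"
      by blast
    finally show "f x \<in> f ` U \<longleftrightarrow> (\<exists>s\<in>K. \<exists>u\<in>U. x = u \<otimes> s)" .
  qed
  then show ?thesis
    using openin_Union_translates [OF U subgroup.subset [OF subgroup_K]] sub
    by (auto simp: openin_quotient_topology)
qed

lemma continuous_coset: "continuous_map (top_of_set (carrier G)) X (\<lambda>x. x <# H)"
  by (rule continuous_map_quotient_topology)

lemma continuous_\<Phi>: "continuous_map X Y \<Phi>"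
proof (rule continuous_map_from_quotient_topology)
  show "continuous_map (top_of_set (carrier G)) Y (\<Phi> \<circ> (\<lambda>x. x <# H))"
    by (rule continuous_map_eq [OF continuous_map_quotient_topology [of "top_of_set (carrier G)" f]])
      (simp add: \<Phi>_coset)
qed

lemma open_map_\<Phi>: "open_map X Y \<Phi>"
  unfolding open_map_def
proof (intro allI impI)
  fix U assume U: "openin X U"
  define V where "V = {x \<in> carrier G. x <# H \<in> U}"
  have "openin (top_of_set (carrier G)) V"
    using U by (simp add: openin_quotient_topology V_def)
  moreover have "\<Phi> ` U = f ` V"
  proof -
    have "U \<subseteq> (\<lambda>x. x <# H) ` carrier G"
      using openin_subset [OF U] by (simp add: topspace_X)
    then have "U = (\<lambda>x. x <# H) ` V"
      unfolding V_def by blast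
    moreover have "\<Phi> ` (\<lambda>x. x <# H) ` V = f ` V"
      unfolding image_image V_def by (intro image_cong) (simp_all add: \<Phi>_coset)
    ultimately show ?thesis by simp
  qed
  ultimately show "openin Y (\<Phi> ` U)"
    using openin_Y_image by simp
qed

text \<open>The sheets over the image of a ball of radius \<open>\<epsilon>/2\<close> are the images of its right translates by
  elements of \<open>K\<close>: by bi-invariance two points of such a ball that differ by an element of \<open>K\<close>
  differ by an element of \<open>H\<close>.\<close>

lemma covering_map_\<Phi>: "covering_map X Y \<Phi>"
  unfolding covering_map_def
proof (intro conjI ballI)
  show "continuous_map X Y \<Phi>"
    by (rule continuous_\<Phi>)
  show "\<Phi> ` topspace X = topspace Y"
    unfolding topspace_X topspace_Y image_image by (intro image_cong) (simp_all add: \<Phi>_coset)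
  fix y assume "y \<in> topspace Y"
  then obtain u where u: "u \<in> carrier G" "y = f u"
    by (auto simp: topspace_Y)
  define B where "B = carrier G \<inter> ball u (\<epsilon>/2)"
  have BG: "b \<in> carrier G" if "b \<in> B" for b
    using that by (simp add: B_def)
  have B: "openin (top_of_set (carrier G)) B"
    unfolding B_def by (simp add: openin_open_Int)
  have BH: "inv a \<otimes> b \<in> H" if a: "a \<in> B" and b: "b \<in> B" and K: "inv a \<otimes> b \<in> K" for a b
  proof -
    have "dist (inv a \<otimes> b) \<one> = dist (a \<otimes> (inv a \<otimes> b)) (a \<otimes> \<one>)"
      using a b BG by (intro dist_left [symmetric]) auto
    also have "\<dots> = dist b a"
      using a b BG by simp
    also have "\<dots> < \<epsilon>"
      using a b dist_triangle_half_r [of u b \<epsilon> a] by (simp add: B_def)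
    finally show ?thesis
      using near K by blast
  qed
  define S where "S w = (\<lambda>b. (b \<otimes> w) <# H) ` B" for w
  have S_open: "openin X (S w)" if "w \<in> K" for w
    using openin_X_image [OF openin_translate [OF B K_carrier [OF that]]]
    by (simp add: S_def image_image)
  have \<Phi>S: "\<Phi> ((b \<otimes> w) <# H) = f b" if "b \<in> B" "w \<in> K" for b w
    using that BG K_carrier by (simp add: \<Phi>_coset fiber inv_mult_group m_assoc inv_mem)
  show "\<exists>T. y \<in> T \<and> openin Y T \<and>
        (\<exists>\<V>. \<Union>\<V> = topspace X \<inter> \<Phi> -` T \<and> (\<forall>U\<in>\<V>. openin X U) \<and> pairwise disjnt \<V> \<and>
             (\<forall>U\<in>\<V>. homeomorphic_map (subtopology X U) (subtopology Y T) \<Phi>))"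
  proof (intro exI [of _ "f ` B"] exI [of _ "S ` K"] conjI)
    show "y \<in> f ` B"
      using u pos by (auto simp: B_def)
    show "openin Y (f ` B)"
      by (rule openin_Y_image [OF B])
    show "\<Union> (S ` K) = topspace X \<inter> \<Phi> -` f ` B"
    proof
      show "\<Union> (S ` K) \<subseteq> topspace X \<inter> \<Phi> -` f ` B"
        using \<Phi>S BG K_carrier by (auto simp: S_def topspace_X)
      show "topspace X \<inter> \<Phi> -` f ` B \<subseteq> \<Union> (S ` K)"
      proof
        fix A assume "A \<in> topspace X \<inter> \<Phi> -` f ` B"
        then obtain x b where x: "x \<in> carrier G" "A = x <# H" and b: "b \<in> B" "f x = f b"
          by (auto simp: topspace_X \<Phi>_coset)
        then have "inv b \<otimes> x \<in> K"
          using fiber [of b x] BG by simp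
        moreover have "A = (b \<otimes> (inv b \<otimes> x)) <# H"
          using x b BG by simp
        ultimately show "A \<in> \<Union> (S ` K)"
          using b unfolding S_def by blast
      qed
    qed
    show "\<forall>U\<in>S ` K. openin X U"
      using S_open by blast
    show "pairwise disjnt (S ` K)"
    proof (clarsimp simp: pairwise_image pairwise_def)
      fix w w' assume w: "w \<in> K" "w' \<in> K" and ne: "S w \<noteq> S w'"
      show "disjnt (S w) (S w')"
      proof (rule ccontr)
        assume "\<not> disjnt (S w) (S w')"
        then obtain a b where ab: "a \<in> B" "b \<in> B" "(a \<otimes> w) <# H = (b \<otimes> w') <# H"
          by (auto simp: disjnt_def S_def)
        then have h: "inv w \<otimes> (inv a \<otimes> b) \<otimes> w' \<in> H"
          using w BG K_carrier by (simp add: coset_eq_iff inv_mult_group m_assoc)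
        \<comment> \<open>Equal images put \<open>inv a \<otimes> b\<close> in \<open>K\<close>,
          hence in \<open>H\<close> by \<open>BH\<close>. The conjugate by \<open>w\<close> of its
          inverse, multiplied with \<open>h\<close>, leaves \<open>inv w \<otimes> w'\<close>; so
          \<open>w\<close> and \<open>w'\<close> have the same coset, and a sheet depends only on
          that coset.\<close>
        have "f a = f b"
          using ab \<Phi>S w by metis
        then have "inv a \<otimes> b \<in> H"
          using ab BG BH fiber by simp
        then have "inv w \<otimes> inv (inv a \<otimes> b) \<otimes> w \<in> H"
          using conj_mem w inv_mem by blast
        from mult_mem(1) [OF this h] have "inv w \<otimes> w' \<in> H"
          using w ab BG K_carrier
          by (simp add: m_assoc inv_mult_group)
        then have "w <# H = w' <# H"
          using w K_carrier by (simp add: coset_eq_iff)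
        moreover have "S v = (\<lambda>b. (b <# H) <#> (v <# H)) ` B" if "v \<in> K" for v
          using that BG by (simp add: S_def coset_mult_coset)
        ultimately show False
          using ne w by simp
      qed
    qed
    show "\<forall>U\<in>S ` K. homeomorphic_map (subtopology X U) (subtopology Y (f ` B)) \<Phi>"
    proof clarify
      fix w assume w: "w \<in> K"
      have SX: "topspace X \<inter> S w = S w" and fY: "topspace Y \<inter> f ` B = f ` B"
        using openin_subset [OF S_open [OF w]] openin_subset [OF openin_Y_image [OF B]] by auto
      have img: "\<Phi> ` S w = f ` B"
        using \<Phi>S w unfolding S_def image_image by (intro image_cong) auto
      show "homeomorphic_map (subtopology X (S w)) (subtopology Y (f ` B)) \<Phi>"
      proof (rule bijective_open_imp_homeomorphic_map)
        show "continuous_map (subtopology X (S w)) (subtopology Y (f ` B)) \<Phi>"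
          using continuous_\<Phi> img by (auto simp: continuous_map_in_subtopology
              continuous_map_from_subtopology)
        have "open_map (subtopology X (S w)) Y \<Phi>"
          using open_map_\<Phi> S_open [OF w] by (simp add: open_map_def openin_open_subtopology)
        then show "open_map (subtopology X (S w)) (subtopology Y (f ` B)) \<Phi>"
          using img by (intro open_map_into_subtopology) auto
        show "\<Phi> ` topspace (subtopology X (S w)) = topspace (subtopology Y (f ` B))"
          using img SX fY by simp
        have "inj_on \<Phi> (S w)"
        proof (rule inj_onI)
          fix P Q assume "P \<in> S w" "Q \<in> S w" and eq: "\<Phi> P = \<Phi> Q"
          then obtain a b where ab: "a \<in> B" "b \<in> B" "P = (a \<otimes> w) <# H" "Q = (b \<otimes> w) <# H"
            by (auto simp: S_def)
          then have "inv a \<otimes> b \<in> H"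
            using eq \<Phi>S w BH fiber BG by simp
          then have "a <# H = b <# H"
            using ab BG by (simp add: coset_eq_iff)
          then show "P = Q"
            using ab BG w by (simp flip: coset_mult_coset)
        qed
        then show "inj_on \<Phi> (topspace (subtopology X (S w)))"
          using SX by simp
      qed
    qed
  qed
qed

section \<open>The right action and the covering transformations\<close>

lemma connected_X: "connected_space X"
proof -
  have "connectedin (top_of_set (carrier G)) (carrier G)"
    using connected_carrier by (simp add: connectedin_subtopology)
  from connectedin_continuous_map_image [OF continuous_coset this]
  show ?thesis
    by (simp add: topspace_X flip: connectedin_topspace)
qed

lemma act_coset:
  assumes "x \<in> carrier G" "w \<in> K"
  shows "act (w <# H) (x <# H) = (x \<otimes> w) <# H"
  using assms by (auto simp: act_def topspace_X coset_mult_coset)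

lemma continuous_act:
  assumes w: "w \<in> K" shows "continuous_map X X (act (w <# H))"
proof (rule continuous_map_from_quotient_topology)
  have "continuous_on (carrier G) (\<lambda>x. x \<otimes> w)"
    unfolding continuous_on_iff
    by (intro ballI allI impI exI conjI) (use w in \<open>auto simp: dist_right K_carrier\<close>)
  then have "continuous_map (top_of_set (carrier G)) (top_of_set (carrier G)) (\<lambda>x. x \<otimes> w)"
    using w K_carrier by auto
  from continuous_map_compose [OF this continuous_coset]
  show "continuous_map (top_of_set (carrier G)) X (act (w <# H) \<circ> (\<lambda>x. x <# H))"
    by (rule continuous_map_eq) (simp add: act_coset w)
qed

lemma act_act_inv:
  assumes "w \<in> K" "A \<in> topspace X"
  shows "act (w <# H) (act (inv w <# H) A) = A"
  using assms by (auto simp: topspace_X act_coset inv_mem m_assoc K_carrier)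

lemma \<Phi>_act: "\<lbrakk>w \<in> K; A \<in> topspace X\<rbrakk> \<Longrightarrow> \<Phi> (act (w <# H) A) = \<Phi> A"
  by (auto simp: topspace_X act_coset \<Phi>_coset K_carrier fiber inv_mult_group m_assoc inv_mem)

lemma homeomorphic_act:
  assumes w: "w \<in> K" shows "homeomorphic_map X X (act (w <# H))"
  unfolding homeomorphic_map_maps homeomorphic_maps_def
  using w continuous_act act_act_inv [of w] act_act_inv [of "inv w"] inv_mem(2) K_carrier
  by (intro exI [of _ "act (inv w <# H)"]) simp

lemma act_Bij: "w \<in> K \<Longrightarrow> act (w <# H) \<in> Bij (topspace X)"
  using homeomorphic_imp_injective_map [OF homeomorphic_act, of w]
    homeomorphic_imp_surjective_map [OF homeomorphic_act, of w]
  by (simp add: Bij_def bij_betw_def) (simp add: act_def)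

lemma carrier_deck:
  "carrier (deck_group X \<Phi>) = {g \<in> Bij (topspace X). homeomorphic_map X X g \<and> (\<forall>A\<in>topspace X. \<Phi> (g A) = \<Phi> A)}"
  by (simp add: deck_group_def)

lemma act_deck: "w \<in> K \<Longrightarrow> act (w <# H) \<in> carrier (deck_group X \<Phi>)"
  by (simp add: carrier_deck act_Bij homeomorphic_act \<Phi>_act)

lemma deck_is_act:
  assumes g: "g \<in> carrier (deck_group X \<Phi>)"
  shows "\<exists>w\<in>K. g = act (w <# H)"
proof -
  have 1: "\<one> <# H \<in> topspace X"
    by (simp add: topspace_X)
  have gX: "homeomorphic_map X X g" and g\<Phi>: "\<And>A. A \<in> topspace X \<Longrightarrow> \<Phi> (g A) = \<Phi> A"
    and gB: "g \<in> Bij (topspace X)"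
    using g by (auto simp: carrier_deck)
  have gc: "continuous_map X X g"
    using gX homeomorphic_imp_continuous_map by blast
  then have "g (\<one> <# H) \<in> topspace X"
    using 1 by (auto simp: continuous_map_def)
  then obtain w where w: "w \<in> carrier G" "g (\<one> <# H) = w <# H"
    by (auto simp: topspace_X)
  then have "f \<one> = f w"
    using g\<Phi> [OF 1] by (simp add: \<Phi>_coset)
  then have wK: "w \<in> K"
    using fiber w by simp
  have "g A = act (w <# H) A" if "A \<in> topspace X" for A
  proof (rule covering_map_lift_unique [OF covering_map_\<Phi> connected_X gc continuous_act [OF wK] _ 1])
    show "g (\<one> <# H) = act (w <# H) (\<one> <# H)"
      using w wK by (simp add: act_coset)
  qed (use that g\<Phi> \<Phi>_act wK in auto)
  then have "g = act (w <# H)"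
    using gB act_Bij [OF wK] by (intro extensionalityI [where A = "topspace X"]) (auto simp: Bij_def)
  then show ?thesis
    using wK by blast
qed

text \<open>For a right action, acting by a product \<open>C D\<close> means acting by
  \<open>C\<close> before \<open>D\<close>, which is the reverse of composition. Inverting first
  turns this anti-homomorphism into a homomorphism. Injectivity is read off at the coset of the
  unit, surjectivity is \<open>deck_is_act\<close>.\<close>

lemma act_iso: "(\<lambda>C\<in>carrier W. act (inv\<^bsub>W\<^esub> C)) \<in> iso W (deck_group X \<Phi>)"
proof -
  define \<rho> where "\<rho> = (\<lambda>C\<in>carrier W. act (inv\<^bsub>W\<^esub> C))"
  have \<rho>: "\<rho> (w <# H) = act (inv w <# H)" if "w \<in> K" for w
    using that by (auto simp: \<rho>_def carrier_W inv_W)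
  have mult: "\<rho> (C \<otimes>\<^bsub>W\<^esub> D) = \<rho> C \<otimes>\<^bsub>deck_group X \<Phi>\<^esub> \<rho> D"
    if CD: "C \<in> carrier W" "D \<in> carrier W" for C D
  proof -
    obtain v w where vw: "v \<in> K" "w \<in> K" "C = v <# H" "D = w <# H"
      using CD by (auto simp: carrier_W)
    have "\<rho> (C \<otimes>\<^bsub>W\<^esub> D) = act (inv w \<otimes> inv v <# H)"
      unfolding mult_W using vw by (simp add: coset_mult_coset K_carrier \<rho> mult_mem inv_mult_group)
    also have "\<dots> = compose (topspace X) (act (inv v <# H)) (act (inv w <# H))"
    proof
      fix A
      show "act (inv w \<otimes> inv v <# H) A = compose (topspace X) (act (inv v <# H)) (act (inv w <# H)) A"
      proof (cases "A \<in> topspace X")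
        case True
        then show ?thesis
          using vw by (auto simp: compose_eq topspace_X act_coset K_carrier inv_mem mult_mem m_assoc)
      next
        case False
        then show ?thesis
          by (simp add: act_def compose_def)
      qed
    qed
    also have "\<dots> = \<rho> C \<otimes>\<^bsub>deck_group X \<Phi>\<^esub> \<rho> D"
      using vw by (simp add: deck_group_def BijGroup_def \<rho> act_Bij inv_mem)
    finally show ?thesis .
  qed
  have "inj_on \<rho> (carrier W)"
  proof (rule inj_onI)
    fix C D assume CD: "C \<in> carrier W" "D \<in> carrier W" and eq: "\<rho> C = \<rho> D"
    obtain v w where vw: "v \<in> K" "w \<in> K" "C = v <# H" "D = w <# H"
      using CD by (auto simp: carrier_W)
    have "inv v <# H = inv w <# H"
      using fun_cong [OF eq, of "\<one> <# H"] vw by (simp add: \<rho> act_coset inv_mem K_carrier)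
    then have "inv\<^bsub>W\<^esub> C = inv\<^bsub>W\<^esub> D"
      using vw by (simp add: inv_W)
    then show "C = D"
      using CD group.inv_inv [OF group_W] by metis
  qed
  moreover have "\<rho> ` carrier W = carrier (deck_group X \<Phi>)"
  proof
    show "\<rho> ` carrier W \<subseteq> carrier (deck_group X \<Phi>)"
      using act_deck inv_mem(2) by (auto simp: carrier_W \<rho>)
    show "carrier (deck_group X \<Phi>) \<subseteq> \<rho> ` carrier W"
    proof
      fix g assume "g \<in> carrier (deck_group X \<Phi>)"
      then obtain w where "w \<in> K" "g = act (w <# H)"
        using deck_is_act by blast
      then have "g = \<rho> (inv w <# H)" "inv w <# H \<in> carrier W"
        using \<rho> [of "inv w"] inv_mem by (auto simp: K_carrier carrier_W)
      then show "g \<in> \<rho> ` carrier W" by blast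
    qed
  qed
  ultimately have "\<rho> \<in> iso W (deck_group X \<Phi>)"
    using mult by (auto simp: iso_def hom_def bij_betw_def)
  then show ?thesis
    by (simp only: \<rho>_def)
qed

end

section \<open>Conditional expectations\<close>

lemma positive_op_alt: "positive_op T \<longleftrightarrow> T \<in> bounded_ops \<and> (\<forall>x. cinner (T x) x \<in> \<real> \<and> 0 \<le> Re (cinner (T x) x))"
  unfolding positive_op_def complex_nonneg_Reals_iff complex_is_Real_iff by auto

lemma positive_hadj_compose_self: "T \<in> bounded_ops \<Longrightarrow> positive_op (hadj T o\<^sub>L T)"
  unfolding positive_op_alt
  by (auto simp: bounded_ops_closure hadj_bounded_ops cinner_hadj_compose_self simp del: blinfun_apply_blinfun_compose)

lemma cinner_self_adjoint_real:
  assumes "T \<in> bounded_ops" "hadj T = T"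
  shows "cinner (T x) x \<in> \<real>"
proof -
  have "cinner (T x) x = cnj (cinner (T x) x)"
    using cinner_hadj_right [OF assms(1), of x x] cinner_commute [of x "T x"] assms(2) by simp
  then show ?thesis
    using Reals_cnj_iff by metis
qed

text \<open>Makes a self-adjoint operator accessible to a positive map: it is this positive operator
  minus a multiple of the identity.\<close>

lemma positive_add_norm:
  assumes "T \<in> bounded_ops" "hadj T = T"
  shows "positive_op (T + norm T *\<^sub>R id_blinfun)"
  unfolding positive_op_alt
proof (intro conjI allI)
  show "T + norm T *\<^sub>R id_blinfun \<in> bounded_ops"
    by (intro bounded_ops_closure assms)
  fix x
  have eq: "cinner ((T + norm T *\<^sub>R id_blinfun) x) x = cinner (T x) x + of_real (norm T * (norm x)\<^sup>2)"
    by (simp add: blinfun.bilinear_simps cinner_simps cinner_self)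
  show "cinner ((T + norm T *\<^sub>R id_blinfun) x) x \<in> \<real>"
    unfolding eq using cinner_self_adjoint_real [OF assms] by (intro Reals_add) auto
  have "cmod (cinner (T x) x) \<le> norm T * (norm x)\<^sup>2"
    unfolding power2_eq_square mult.assoc [symmetric]
    by (intro order_trans [OF Cauchy_Schwarz_cinner] mult_right_mono norm_blinfun) simp
  then show "0 \<le> Re (cinner ((T + norm T *\<^sub>R id_blinfun) x) x)"
    unfolding eq using abs_Re_le_cmod [of "cinner (T x) x"] by simp
qed

text \<open>With \<open>k = 1 - z\<close>, a right inverse is the fixed point of
  \<open>r = 1 + k r\<close> and a left inverse that of \<open>l = 1 + l k\<close>; both maps are
  contractions, and the two inverses coincide. The final estimate keeps the inverse close enough to
  1 for its root to exist.\<close>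

lemma inverse_near_id:
  fixes z :: "'h::complex_hilbert_space oper"
  assumes z: "norm (id_blinfun - z) < 1"
  obtains r where "z o\<^sub>L r = id_blinfun" "r o\<^sub>L z = id_blinfun"
    "norm (id_blinfun - r) * (1 - norm (id_blinfun - z)) \<le> norm (id_blinfun - z)"
proof -
  define k where "k = id_blinfun - z"
  have "\<exists>!r. id_blinfun + (k o\<^sub>L r) = r"
  proof (rule banach_fix_type [of "norm k"])
    show "\<forall>x y. dist (id_blinfun + (k o\<^sub>L x)) (id_blinfun + (k o\<^sub>L y)) \<le> norm k * dist x y"
      using norm_blinfun_compose [of k] by (metis dist_norm compose_simps(4) add_diff_cancel_left)
  qed (use z in \<open>auto simp: k_def\<close>)
  then obtain r where r: "id_blinfun + (k o\<^sub>L r) = r" by blast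
  have "\<exists>!l. id_blinfun + (l o\<^sub>L k) = l"
  proof (rule banach_fix_type [of "norm k"])
    show "\<forall>x y. dist (id_blinfun + (x o\<^sub>L k)) (id_blinfun + (y o\<^sub>L k)) \<le> norm k * dist x y"
      using norm_blinfun_compose [of _ k]
      by (metis dist_norm compose_simps(3) add_diff_cancel_left mult.commute)
  qed (use z in \<open>auto simp: k_def\<close>)
  then obtain l where l: "id_blinfun + (l o\<^sub>L k) = l" by blast
  have zr: "z o\<^sub>L r = id_blinfun"
    using r by (simp add: k_def compose_simps algebra_simps)
  have lz: "l o\<^sub>L z = id_blinfun"
    using l by (simp add: k_def compose_simps algebra_simps)
  have "l = l o\<^sub>L (z o\<^sub>L r)"
    by (simp add: zr)
  then have "l = r"
    by (simp add: lz flip: compose_assoc)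
  \<comment> \<open>Gives \<open>norm (1 - r) \<le> norm k * norm r\<close>, with
    \<open>norm r\<close> at most \<open>1 + norm (1 - r)\<close>; collecting the terms in
    \<open>norm (1 - r)\<close> is the claimed estimate.\<close>
  have "id_blinfun - r = - (k o\<^sub>L r)"
    using r by (simp add: algebra_simps eq_neg_iff_add_eq_0)
  then have "norm (id_blinfun - r) \<le> norm k * norm r"
    using norm_blinfun_compose [of k r] by simp
  also have "\<dots> \<le> norm k * (1 + norm (id_blinfun - r))"
  proof (rule mult_left_mono)
    have "norm r \<le> norm (id_blinfun :: 'h oper) + norm (id_blinfun - r)"
      using norm_triangle_ineq4 [of id_blinfun "id_blinfun - r"] by simp
    then show "norm r \<le> 1 + norm (id_blinfun - r)"
      using norm_blinfun_id_le [where 'a = 'h] by linarith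
  qed simp
  finally have "norm (id_blinfun - r) * (1 - norm k) \<le> norm k"
    by (simp add: algebra_simps)
  then show thesis
    using that zr lz \<open>l = r\<close> by (simp add: k_def)
qed

lemma commute_inverse:
  assumes "z o\<^sub>L r = id_blinfun" "r o\<^sub>L z = id_blinfun" "T o\<^sub>L z = z o\<^sub>L T"
  shows "T o\<^sub>L r = r o\<^sub>L T"
proof -
  have "T o\<^sub>L r = r o\<^sub>L (z o\<^sub>L T) o\<^sub>L r"
    by (simp add: assms(2) flip: compose_assoc)
  also have "\<dots> = r o\<^sub>L T o\<^sub>L (z o\<^sub>L r)"
    by (simp add: compose_assoc flip: assms(3))
  finally show ?thesis
    by (simp add: assms(1))
qed

section \<open>Unitary groups of von Neumann algebras\<close>

lemma unitary_cancel:
  assumes "u \<in> unitaries A"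
  shows "hadj u o\<^sub>L (u o\<^sub>L x) = x" "u o\<^sub>L (hadj u o\<^sub>L x) = x"
  using unitariesD [OF assms] by (simp_all flip: compose_assoc)

lemma unitaries_closure:
  assumes A: "von_neumann_algebra A"
  shows "id_blinfun \<in> unitaries A"
    and "u \<in> unitaries A \<Longrightarrow> v \<in> unitaries A \<Longrightarrow> u o\<^sub>L v \<in> unitaries A"
    and "u \<in> unitaries A \<Longrightarrow> hadj u \<in> unitaries A"
proof -
  note cl = von_neumann_algebra_closure [OF A]
  show "id_blinfun \<in> unitaries A"
    by (simp add: unitaries_def cl)
  show "u o\<^sub>L v \<in> unitaries A" if u: "u \<in> unitaries A" and v: "v \<in> unitaries A"
    using unitariesD [OF u] unitariesD [OF v]
    by (simp add: unitaries_def cl hadj_compose compose_assoc unitary_cancel [OF u] unitary_cancel [OF v])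
  show "hadj u \<in> unitaries A" if u: "u \<in> unitaries A"
    using unitariesD [OF u] by (simp add: unitaries_def cl hadj_hadj)
qed

lemma unitary_group_simps [simp]:
  "carrier (unitary_group A) = unitaries A"
  "x \<otimes>\<^bsub>unitary_group A\<^esub> y = x o\<^sub>L y"
  "\<one>\<^bsub>unitary_group A\<^esub> = id_blinfun"
  by (simp_all add: unitary_group_def)

lemma group_unitary_group:
  assumes A: "von_neumann_algebra A"
  shows "group (unitary_group A)"
proof (rule groupI)
  show "\<exists>v\<in>carrier (unitary_group A). v \<otimes>\<^bsub>unitary_group A\<^esub> u = \<one>\<^bsub>unitary_group A\<^esub>"
    if "u \<in> carrier (unitary_group A)" for u
    using that unitaries_closure(3) [OF A] by (intro bexI [of _ "hadj u"]) (simp_all add: unitariesD)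
qed (simp_all add: unitaries_closure [OF A] compose_assoc)

lemma inv_unitary_group:
  assumes A: "von_neumann_algebra A" and u: "u \<in> unitaries A"
  shows "inv\<^bsub>unitary_group A\<^esub> u = hadj u"
  using u unitaries_closure(3) [OF A u] unitariesD [OF u]
  by (intro group.inv_equality [OF group_unitary_group [OF A]]) simp_all

text \<open>Multiplication by \<open>u\<close> and by \<open>hadj u\<close> are both contractions
  and undo each other. This is the source of bi-invariance of the distance.\<close>

lemma norm_unitary_compose:
  assumes A: "von_neumann_algebra A" and u: "u \<in> unitaries A"
  shows "norm (u o\<^sub>L x) = norm x" "norm (x o\<^sub>L u) = norm x"
proof -
  have n: "norm v \<le> 1" if "v \<in> unitaries A" for v
    using norm_unitary_le [of v] unitariesD [OF that] von_neumann_algebra_closure(7) [OF A] by blast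
  have le: "norm (v o\<^sub>L y) \<le> norm y" "norm (y o\<^sub>L v) \<le> norm y" if "v \<in> unitaries A" for v y
    using norm_blinfun_compose [of v y] norm_blinfun_compose [of y v] n [OF that]
      mult_right_mono [of "norm v" 1 "norm y"] by (simp_all add: mult.commute)
  have "x = (x o\<^sub>L u) o\<^sub>L hadj u"
    by (simp add: compose_assoc unitariesD [OF u])
  then have "norm x \<le> norm (x o\<^sub>L u)"
    using le(2) [OF unitaries_closure(3) [OF A u], of "x o\<^sub>L u"] by simp
  moreover have "norm x \<le> norm (u o\<^sub>L x)"
    using le(1) [OF unitaries_closure(3) [OF A u], of "u o\<^sub>L x"] by (simp add: unitary_cancel [OF u])
  ultimately show "norm (u o\<^sub>L x) = norm x" "norm (x o\<^sub>L u) = norm x"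
    using le [OF u, of x] by simp_all
qed

locale cond_exp =
  fixes M N :: "'h::complex_hilbert_space oper set" and E :: "'h oper \<Rightarrow> 'h oper"
  assumes M: "von_neumann_algebra M" and N: "von_neumann_algebra N" and NM: "N \<subseteq> M"
    and E: "conditional_expectation M N E"
begin

lemmas M_closure = von_neumann_algebra_closure [OF M]
lemmas N_closure = von_neumann_algebra_closure [OF N]

lemma N_M: "x \<in> N \<Longrightarrow> x \<in> M"
  using NM by blast

lemma
  shows E_N: "x \<in> M \<Longrightarrow> E x \<in> N"
    and E_add: "x \<in> M \<Longrightarrow> y \<in> M \<Longrightarrow> E (x + y) = E x + E y"
    and E_scalar_op: "x \<in> M \<Longrightarrow> E (scalar_op c o\<^sub>L x) = scalar_op c o\<^sub>L E x"
    and E_positive: "x \<in> M \<Longrightarrow> positive_op x \<Longrightarrow> positive_op (E x)"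
    and E_id: "a \<in> N \<Longrightarrow> E a = a"
    and E_bimodule: "a \<in> N \<Longrightarrow> b \<in> N \<Longrightarrow> x \<in> M \<Longrightarrow> E (a o\<^sub>L x o\<^sub>L b) = a o\<^sub>L E x o\<^sub>L b"
  using E by (auto simp: conditional_expectation_def)

lemma E_left: "a \<in> N \<Longrightarrow> x \<in> M \<Longrightarrow> E (a o\<^sub>L x) = a o\<^sub>L E x"
  using E_bimodule [of a id_blinfun x] N_closure by simp

lemma E_right: "b \<in> N \<Longrightarrow> x \<in> M \<Longrightarrow> E (x o\<^sub>L b) = E x o\<^sub>L b"
  using E_bimodule [of id_blinfun b x] N_closure by simp

lemma E_diff: "x \<in> M \<Longrightarrow> y \<in> M \<Longrightarrow> E (x - y) = E x - E y"
  using E_add [of "x - y" y] M_closure by simp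

text \<open>Positivity of \<open>E\<close> applies to \<open>x\<close> shifted by its norm, and
  \<open>E\<close> fixes the shift, so the quadratic form of \<open>E x\<close> is real.\<close>

lemma E_self_adjoint:
  assumes x: "x \<in> M" "hadj x = x"
  shows "hadj (E x) = E x"
proof (rule self_adjointI)
  show "E x \<in> bounded_ops"
    by (rule N_closure(7) [OF E_N [OF x(1)]])
  have "positive_op (E (x + norm x *\<^sub>R id_blinfun))"
    using x M_closure by (intro E_positive positive_add_norm) auto
  then have pos: "positive_op (E x + norm x *\<^sub>R id_blinfun)"
    using x M_closure N_closure by (simp add: E_add E_id)
  fix v
  have "cinner (E x v) v = cinner ((E x + norm x *\<^sub>R id_blinfun) v) v - of_real (norm x * (norm v)\<^sup>2)"
    by (simp add: blinfun.bilinear_simps cinner_simps cinner_self)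
  then show "cinner (E x v) v \<in> \<real>"
    using pos unfolding positive_op_alt by (metis Reals_diff Reals_of_real)
qed

text \<open>Splitting \<open>x = p + i q\<close> into self-adjoint parts reduces this to
  \<open>E_self_adjoint\<close>, since \<open>E\<close> commutes with the scalar
  \<open>i\<close>.\<close>

lemma E_hadj:
  assumes x: "x \<in> M"
  shows "E (hadj x) = hadj (E x)"
proof -
  let ?J = "scalar_op \<i> :: 'h oper"
  define p where "p = (1/2) *\<^sub>R (x + hadj x)"
  define q where "q = (1/2) *\<^sub>R (?J o\<^sub>L (hadj x - x))"
  have mem: "hadj x \<in> M" "x \<in> bounded_ops" "hadj x \<in> bounded_ops"
    using x M_closure by auto
  have pM: "p \<in> M" and qM: "q \<in> M"
    unfolding p_def q_def by (intro M_closure x mem)+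
  have hp: "hadj p = p"
    using mem by (simp add: p_def hadj_scaleR hadj_add hadj_hadj bounded_ops_closure add.commute)
  have hq: "hadj q = q"
    using mem by (simp add: q_def hadj_scaleR hadj_compose hadj_diff hadj_hadj bounded_ops_closure
        hadj_scalar_op_ii scalar_op_commute compose_simps)
  have half: "(1/2) *\<^sub>R y + (1/2) *\<^sub>R y = y" for y :: "'h oper"
    by (simp flip: scaleR_add_left)
  have xpq: "x = p + (?J o\<^sub>L q)" and hxpq: "hadj x = p - (?J o\<^sub>L q)"
    using half by (simp_all add: p_def q_def compose_simps scalar_op_ii_cancel algebra_simps)
  have JqM: "?J o\<^sub>L q \<in> M"
    by (intro M_closure qM)
  have Eb: "E p \<in> bounded_ops" "E q \<in> bounded_ops"
    using E_N pM qM N_closure by auto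
  have Ex: "E x = E p + (?J o\<^sub>L E q)" "E (hadj x) = E p - (?J o\<^sub>L E q)"
    unfolding hxpq by (subst xpq) (simp_all add: E_add E_diff E_scalar_op pM qM JqM)
  have "hadj (E x) = E p - (?J o\<^sub>L E q)"
    unfolding Ex using Eb E_self_adjoint pM qM hp hq
    by (simp add: hadj_add hadj_compose bounded_ops_closure hadj_scalar_op_ii compose_simps scalar_op_commute)
  then show ?thesis
    by (simp add: Ex)
qed

text \<open>Kadison--Schwarz: expand \<open>E ((x - E x)\<^sup>* (x - E x)) \<ge> 0\<close>.\<close>

lemma norm_E_le:
  assumes x: "x \<in> M"
  shows "norm (E x) \<le> norm x"
proof (rule norm_blinfun_bound)
  have ExN: "E x \<in> N" "hadj (E x) \<in> N" and mem: "E x \<in> M" "hadj (E x) \<in> M" "hadj x \<in> M"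
    "x \<in> bounded_ops" "E x \<in> bounded_ops"
    using x E_N N_closure N_M M_closure by auto
  have "positive_op (E (hadj (x - E x) o\<^sub>L (x - E x)))"
    using x mem M_closure by (intro E_positive positive_hadj_compose_self) auto
  moreover have "E (hadj (x - E x) o\<^sub>L (x - E x)) = E (hadj x o\<^sub>L x) - (hadj (E x) o\<^sub>L E x)"
    using x mem ExN M_closure
    by (simp add: hadj_diff compose_simps E_diff E_left E_right E_hadj E_id)
  ultimately have KS: "positive_op (E (hadj x o\<^sub>L x) - (hadj (E x) o\<^sub>L E x))"
    by simp
  \<comment> \<open>The upper half of the estimate: \<open>x* x\<close> lies below the multiple of
    the identity, and \<open>E\<close> preserves this order, so \<open>E (x* x)\<close> is squeezed
    between \<open>(E x)* (E x)\<close> and that multiple.\<close>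
  have "positive_op ((norm x)\<^sup>2 *\<^sub>R id_blinfun - (hadj x o\<^sub>L x))"
    unfolding positive_op_alt
  proof (intro conjI allI)
    show "(norm x)\<^sup>2 *\<^sub>R id_blinfun - (hadj x o\<^sub>L x) \<in> bounded_ops"
      using mem by (intro bounded_ops_closure hadj_bounded_ops)
    fix v
    have eq: "cinner (((norm x)\<^sup>2 *\<^sub>R id_blinfun - (hadj x o\<^sub>L x)) v) v =
        of_real ((norm x * norm v)\<^sup>2 - (norm (x v))\<^sup>2)"
      using cinner_hadj_compose_self [OF mem(4), of v]
      by (simp add: blinfun.bilinear_simps cinner_simps cinner_self power_mult_distrib)
    show "cinner (((norm x)\<^sup>2 *\<^sub>R id_blinfun - (hadj x o\<^sub>L x)) v) v \<in> \<real>"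
      unfolding eq by simp
    have "(norm (x v))\<^sup>2 \<le> (norm x * norm v)\<^sup>2"
      by (intro power_mono norm_blinfun) simp
    then show "0 \<le> Re (cinner (((norm x)\<^sup>2 *\<^sub>R id_blinfun - (hadj x o\<^sub>L x)) v) v)"
      unfolding eq by simp
  qed
  then have "positive_op (E ((norm x)\<^sup>2 *\<^sub>R id_blinfun - (hadj x o\<^sub>L x)))"
    using x mem M_closure by (intro E_positive) auto
  then have bound: "positive_op ((norm x)\<^sup>2 *\<^sub>R id_blinfun - E (hadj x o\<^sub>L x))"
    using x mem M_closure N_closure by (simp add: E_diff E_id)
  fix v
  have "0 \<le> Re (cinner ((E (hadj x o\<^sub>L x) - (hadj (E x) o\<^sub>L E x)) v) v)"
    "0 \<le> Re (cinner (((norm x)\<^sup>2 *\<^sub>R id_blinfun - E (hadj x o\<^sub>L x)) v) v)"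
    using KS bound unfolding positive_op_alt by blast+
  then have "(norm (E x v))\<^sup>2 \<le> (norm x * norm v)\<^sup>2"
    using cinner_hadj_compose_self [OF mem(5), of v]
    by (simp add: blinfun.bilinear_simps cinner_simps cinner_self power_mult_distrib)
  then show "norm (E x v) \<le> norm x * norm v"
    by (rule power2_le_imp_le) simp
qed simp

section \<open>The normalizer of the expectation and its subgroup\<close>

abbreviation "NE \<equiv> normalizer_exp M E"
abbreviation "HE \<equiv> H_exp M N E"
abbreviation "U \<equiv> unitary_group M"

text \<open>Products are nested to the right, the normal form reached by
  \<open>compose_assoc\<close>.\<close>

lemma normalizerD:
  assumes "u \<in> NE"
  shows "u \<in> unitaries M" "x \<in> M \<Longrightarrow> E (u o\<^sub>L (x o\<^sub>L hadj u)) = u o\<^sub>L (E x o\<^sub>L hadj u)"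
  using assms by (auto simp: normalizer_exp_def compose_assoc)

lemma normalizerI:
  assumes "u \<in> unitaries M" "\<And>x. x \<in> M \<Longrightarrow> E (u o\<^sub>L (x o\<^sub>L hadj u)) = u o\<^sub>L (E x o\<^sub>L hadj u)"
  shows "u \<in> NE"
  using assms by (auto simp: normalizer_exp_def compose_assoc)

lemma unitary_mem:
  assumes "u \<in> unitaries M"
  shows "u \<in> M" "hadj u \<in> M" "u \<in> bounded_ops" "hadj u \<in> bounded_ops" "hadj (hadj u) = u"
  using unitariesD(1) [OF assms] M_closure by (auto simp: hadj_hadj)

lemma unitaries_N_M: "u \<in> unitaries N \<Longrightarrow> u \<in> unitaries M"
  using NM by (auto simp: unitaries_def)

lemma normalizer_mult:
  assumes u: "u \<in> NE" and v: "v \<in> NE"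
  shows "u o\<^sub>L v \<in> NE"
proof (rule normalizerI)
  note uD = normalizerD [OF u] and vD = normalizerD [OF v]
  show "u o\<^sub>L v \<in> unitaries M"
    using uD(1) vD(1) by (rule unitaries_closure [OF M])
  fix x assume x: "x \<in> M"
  note mem = unitary_mem [OF uD(1)] unitary_mem [OF vD(1)]
  have "v o\<^sub>L (x o\<^sub>L hadj v) \<in> M"
    by (intro M_closure mem x)
  then show "E ((u o\<^sub>L v) o\<^sub>L (x o\<^sub>L hadj (u o\<^sub>L v))) = (u o\<^sub>L v) o\<^sub>L (E x o\<^sub>L hadj (u o\<^sub>L v))"
    using uD(2) [of "v o\<^sub>L (x o\<^sub>L hadj v)"] vD(2) [OF x] mem
    by (simp add: hadj_compose compose_assoc)
qed

lemma normalizer_hadj: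
  assumes u: "u \<in> NE"
  shows "hadj u \<in> NE"
proof (rule normalizerI)
  note uD = normalizerD [OF u]
  note mem = unitary_mem [OF uD(1)] and cancel = unitary_cancel [OF uD(1)]
  show "hadj u \<in> unitaries M"
    using uD(1) by (rule unitaries_closure [OF M])
  fix x assume x: "x \<in> M"
  define y where "y = hadj u o\<^sub>L (x o\<^sub>L u)"
  have "y \<in> M"
    unfolding y_def by (intro M_closure mem x)
  then have "E (u o\<^sub>L (y o\<^sub>L hadj u)) = u o\<^sub>L (E y o\<^sub>L hadj u)"
    by (rule uD(2))
  moreover have "u o\<^sub>L (y o\<^sub>L hadj u) = x"
    by (simp add: y_def compose_assoc cancel unitariesD [OF uD(1)])
  ultimately have "E x = u o\<^sub>L (E y o\<^sub>L hadj u)"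
    by simp
  then show "E (hadj u o\<^sub>L (x o\<^sub>L hadj (hadj u))) = hadj u o\<^sub>L (E x o\<^sub>L hadj (hadj u))"
    by (simp add: mem(5) compose_assoc cancel unitariesD [OF uD(1)] flip: y_def)
qed

lemma unitaries_N_normalizer:
  assumes v: "v \<in> unitaries N"
  shows "v \<in> NE"
proof (rule normalizerI)
  show "v \<in> unitaries M"
    using v by (rule unitaries_N_M)
  show "E (v o\<^sub>L (x o\<^sub>L hadj v)) = v o\<^sub>L (E x o\<^sub>L hadj v)" if "x \<in> M" for x
    using E_bimodule [of v "hadj v" x] unitariesD(1) [OF v] N_closure that by (simp add: compose_assoc)
qed

lemma subgroup_normalizer: "subgroup NE U"
proof (rule group.subgroupI [OF group_unitary_group [OF M]])
  show "NE \<subseteq> carrier U"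
    by (auto simp: normalizer_exp_def)
  have "id_blinfun \<in> NE"
    using unitaries_N_normalizer unitaries_closure(1) [OF N] by blast
  then show "NE \<noteq> {}" by blast
qed (simp_all add: normalizer_mult normalizer_hadj normalizerD inv_unitary_group [OF M])

text \<open>Conjugation by an element commuting with \<open>N\<close> fixes all values of
  \<open>E\<close>, so the trace-like condition of the centralizer turns into normalization of
  \<open>E\<close>. In this form products, adjoints and conjugates are inherited from the normalizer
  and the commutant.\<close>

lemma unitaries_centralizer_iff:
  "w \<in> unitaries (centralizer_exp M N E) \<longleftrightarrow> w \<in> NE \<and> w \<in> commutant N"
proof
  assume w: "w \<in> unitaries (centralizer_exp M N E)"
  then have wc: "w \<in> commutant N" and wE: "\<And>m. m \<in> M \<Longrightarrow> E (w o\<^sub>L m) = E (m o\<^sub>L w)" and wM: "w \<in> unitaries M"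
    by (auto simp: unitaries_def centralizer_exp_def)
  have "w \<in> NE"
  proof (rule normalizerI [OF wM])
    fix x assume x: "x \<in> M"
    have "E (w o\<^sub>L (x o\<^sub>L hadj w)) = E ((x o\<^sub>L hadj w) o\<^sub>L w)"
      using x unitary_mem [OF wM] M_closure by (intro wE) auto
    also have "\<dots> = E x"
      by (simp add: compose_assoc unitariesD [OF wM])
    also have "\<dots> = (w o\<^sub>L E x) o\<^sub>L hadj w"
      using commutantD [OF wc E_N [OF x]] by (simp add: compose_assoc unitariesD [OF wM])
    finally show "E (w o\<^sub>L (x o\<^sub>L hadj w)) = w o\<^sub>L (E x o\<^sub>L hadj w)"
      by (simp add: compose_assoc)
  qed
  then show "w \<in> NE \<and> w \<in> commutant N"
    using wc by blast
next
  assume "w \<in> NE \<and> w \<in> commutant N"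
  then have w: "w \<in> NE" and wc: "w \<in> commutant N" by auto
  note wM = normalizerD(1) [OF w]
  have "E (w o\<^sub>L m) = E (m o\<^sub>L w)" if m: "m \<in> M" for m
  proof -
    have mw: "m o\<^sub>L w \<in> M"
      by (intro M_closure m unitary_mem [OF wM])
    have "E (w o\<^sub>L m) = E (w o\<^sub>L ((m o\<^sub>L w) o\<^sub>L hadj w))"
      by (simp add: compose_assoc unitariesD [OF wM])
    also have "\<dots> = (w o\<^sub>L E (m o\<^sub>L w)) o\<^sub>L hadj w"
      using normalizerD(2) [OF w mw] by (simp add: compose_assoc)
    also have "\<dots> = E (m o\<^sub>L w)"
      using commutantD [OF wc E_N [OF mw]] by (simp add: compose_assoc unitariesD [OF wM])
    finally show ?thesis .
  qed
  then show "w \<in> unitaries (centralizer_exp M N E)"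
    using wc wM by (auto simp: unitaries_def centralizer_exp_def)
qed

lemma H_exp_alt: "HE = {v o\<^sub>L w | v w. v \<in> unitaries N \<and> w \<in> NE \<and> w \<in> commutant N}"
  by (simp add: H_exp_def unitaries_centralizer_iff)

lemma commutant_hadj: "w \<in> commutant N \<Longrightarrow> hadj w \<in> commutant N"
  by (rule hadj_commutant [OF N])

text \<open>Because \<open>E a = a\<close>, the conjugate is a fixed point of \<open>E\<close>, and
  the values of \<open>E\<close> lie in \<open>N\<close>: normalizing \<open>E\<close> entails
  normalizing its range.\<close>

lemma normalizer_conj_N:
  assumes u: "u \<in> NE" and a: "a \<in> N"
  shows "u o\<^sub>L (a o\<^sub>L hadj u) \<in> N"
proof -
  have "u o\<^sub>L (a o\<^sub>L hadj u) \<in> M"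
    using a N_M unitary_mem [OF normalizerD(1) [OF u]] M_closure by auto
  then have "E (u o\<^sub>L (a o\<^sub>L hadj u)) \<in> N"
    by (rule E_N)
  then show ?thesis
    using normalizerD(2) [OF u N_M [OF a]] by (simp add: E_id a)
qed

lemma H_normalizer: "HE \<subseteq> NE"
  using unitaries_N_normalizer normalizer_mult by (auto simp: H_exp_alt)

text \<open>Elements of the two factors commute with each other, so products and adjoints regroup
  into the form \<open>v w\<close>.\<close>

lemma subgroup_H_exp: "subgroup HE U"
proof (rule group.subgroupI [OF group_unitary_group [OF M]])
  show sub: "HE \<subseteq> carrier U"
    using H_normalizer normalizerD(1) by auto
  have "id_blinfun \<in> commutant N"
    by (simp add: commutant_def bounded_ops_closure)
  then have "id_blinfun o\<^sub>L id_blinfun \<in> HE"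
    unfolding H_exp_alt using unitaries_closure(1) [OF N] unitaries_N_normalizer by blast
  then show "HE \<noteq> {}" by blast
  fix g assume g: "g \<in> HE"
  then obtain v w where vw: "v \<in> unitaries N" "w \<in> NE" "w \<in> commutant N" "g = v o\<^sub>L w"
    by (auto simp: H_exp_alt)
  have vN: "v \<in> N" "hadj v \<in> N"
    using unitariesD(1) [OF vw(1)] N_closure by auto
  note mem = unitary_mem [OF unitaries_N_M [OF vw(1)]] unitary_mem [OF normalizerD(1) [OF vw(2)]]
  have "hadj g = hadj v o\<^sub>L hadj w"
    using mem commutantD [OF commutant_hadj [OF vw(3)] vN(2)] by (simp add: vw(4) hadj_compose)
  then have "hadj g \<in> HE"
    unfolding H_exp_alt using unitaries_closure(3) [OF N vw(1)] normalizer_hadj [OF vw(2)]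
      commutant_hadj [OF vw(3)] by blast
  then show "inv\<^bsub>U\<^esub> g \<in> HE"
    using g sub by (simp add: inv_unitary_group [OF M] subset_iff)
  fix h assume "h \<in> HE"
  then obtain v' w' where vw': "v' \<in> unitaries N" "w' \<in> NE" "w' \<in> commutant N" "h = v' o\<^sub>L w'"
    by (auto simp: H_exp_alt)
  have "g o\<^sub>L h = v o\<^sub>L (w o\<^sub>L v') o\<^sub>L w'"
    by (simp add: vw vw' compose_assoc)
  also have "\<dots> = (v o\<^sub>L v') o\<^sub>L (w o\<^sub>L w')"
    using commutantD [OF vw(3) unitariesD(1) [OF vw'(1)]] by (simp add: compose_assoc)
  finally show "g \<otimes>\<^bsub>U\<^esub> h \<in> HE"
    unfolding H_exp_alt unitary_group_simps
    using unitaries_closure(2) [OF N vw(1) vw'(1)] normalizer_mult [OF vw(2) vw'(2)]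
      commutant_closure(3) [OF vw(3) vw'(3)] by blast
qed

text \<open>Conjugation by \<open>u\<close> can be applied to the two factors separately. Both
  \<open>u\<close> and \<open>hadj u\<close> carry \<open>N\<close> into itself, so conjugation by
  \<open>u\<close> preserves \<open>N\<close> and, with it, the commutant of
  \<open>N\<close>.\<close>

lemma normal_H_exp: "HE \<lhd> U\<lparr>carrier := NE\<rparr>"
proof -
  interpret U: group U
    by (rule group_unitary_group [OF M])
  interpret NE: group "U\<lparr>carrier := NE\<rparr>"
    by (rule U.subgroup_imp_group [OF subgroup_normalizer])
  have "u o\<^sub>L h o\<^sub>L hadj u \<in> HE" if u: "u \<in> NE" and "h \<in> HE" for u h
  proof -
    obtain v w where vw: "v \<in> unitaries N" "w \<in> NE" "w \<in> commutant N" "h = v o\<^sub>L w"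
      using \<open>h \<in> HE\<close> by (auto simp: H_exp_alt)
    note uM = normalizerD(1) [OF u]
    note vM = unitaries_N_M [OF vw(1)]
    note mem = unitary_mem [OF uM] unitary_mem [OF vM] and cancel = unitary_cancel [OF uM]
    define v' where "v' = u o\<^sub>L (v o\<^sub>L hadj u)"
    define w' where "w' = u o\<^sub>L (w o\<^sub>L hadj u)"
    have "u o\<^sub>L h o\<^sub>L hadj u = v' o\<^sub>L w'"
      by (simp add: v'_def w'_def vw(4) compose_assoc cancel)
    moreover have "v' \<in> unitaries N"
    proof -
      have "v' \<in> N"
        unfolding v'_def by (rule normalizer_conj_N [OF u unitariesD(1) [OF vw(1)]])
      moreover have "v' \<in> unitaries M"
        unfolding v'_def by (intro unitaries_closure [OF M] uM vM)
      ultimately show ?thesis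
        by (simp add: unitaries_def)
    qed
    moreover have "w' \<in> NE"
      unfolding w'_def by (intro normalizer_mult normalizer_hadj u vw(2))
    moreover have "w' \<in> commutant N"
    proof -
      have "w' o\<^sub>L a = a o\<^sub>L w'" if a: "a \<in> N" for a
      proof -
        define b where "b = hadj u o\<^sub>L (a o\<^sub>L u)"
        have "b \<in> N"
          using normalizer_conj_N [OF normalizer_hadj [OF u] a] by (simp add: b_def mem)
        then have wb: "w o\<^sub>L b = b o\<^sub>L w"
          by (rule commutantD [OF vw(3)])
        have "w' o\<^sub>L a = u o\<^sub>L ((w o\<^sub>L b) o\<^sub>L hadj u)"
          by (simp add: w'_def b_def compose_assoc unitariesD [OF uM])
        also have "\<dots> = a o\<^sub>L w'"
          unfolding wb by (simp add: w'_def b_def compose_assoc cancel)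
        finally show ?thesis .
      qed
      moreover have "w' \<in> M"
        using \<open>w' \<in> NE\<close> normalizerD(1) unitary_mem(1) by blast
      ultimately show ?thesis
        using M_closure by (simp add: commutant_def)
    qed
    ultimately show ?thesis
      unfolding H_exp_alt by blast
  qed
  moreover have "inv\<^bsub>U\<lparr>carrier := NE\<rparr>\<^esub> u = hadj u" if "u \<in> NE" for u
    using U.m_inv_consistent [OF subgroup_normalizer that] that normalizerD(1)
    by (simp add: inv_unitary_group [OF M])
  moreover have "subgroup HE (U\<lparr>carrier := NE\<rparr>)"
    by (rule U.subgroup_incl [OF subgroup_H_exp subgroup_normalizer H_normalizer])
  ultimately show ?thesis
    by (simp add: NE.normal_inv_iff)
qed

text \<open>Let \<open>e = E u\<close>.  Applying \<open>E\<close> to \<open>ua = (uau\<^sup>*)u\<close> gives \<open>ea = (uau\<^sup>*)e\<close> for \<open>a \<in> N\<close>, so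
  \<open>e\<^sup>*e\<close> is central in \<open>N\<close> and the unitary part \<open>v = e(e\<^sup>*e)\<^sup>-\<^sup>1\<^sup>/\<^sup>2\<close> of \<open>e\<close> induces the same automorphism
  of \<open>N\<close> as \<open>u\<close>; hence \<open>v\<^sup>*u\<close> commutes with \<open>N\<close>.\<close>

lemma normalizer_near_id:
  assumes u: "u \<in> NE" and near: "norm (u - id_blinfun) < 1/4"
  shows "u \<in> HE"
proof -
  note uM = normalizerD(1) [OF u]
  note mem = unitary_mem [OF uM] and cancel = unitary_cancel [OF uM]
  define e where "e = E u"
  have eN: "e \<in> N" "hadj e \<in> N" and eb: "e \<in> bounded_ops" "hadj e \<in> bounded_ops"
    using E_N mem(1) N_closure by (auto simp: e_def)
  have "e - id_blinfun = E (u - id_blinfun)"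
    using mem(1) M_closure N_closure by (simp add: e_def E_diff E_id)
  then have "norm (e - id_blinfun) < 1/4"
    using norm_E_le [of "u - id_blinfun"] near mem(1) M_closure by simp
  then have e_near: "norm (id_blinfun - e) < 1/4"
    by (simp add: norm_minus_commute)
  have norm_e: "norm e \<le> 1"
    using norm_E_le [OF mem(1)] norm_unitary_le [OF mem(3) unitariesD(2) [OF uM]] by (simp add: e_def)
  have ea: "e o\<^sub>L a = (u o\<^sub>L (a o\<^sub>L hadj u)) o\<^sub>L e" if a: "a \<in> N" for a
  proof -
    have "e o\<^sub>L a = E ((u o\<^sub>L (a o\<^sub>L hadj u)) o\<^sub>L u)"
      using a mem by (simp add: e_def E_right compose_assoc unitariesD [OF uM])
    then show ?thesis
      using normalizer_conj_N [OF u a] mem by (simp add: e_def E_left)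
  qed
  have ea': "hadj e o\<^sub>L (u o\<^sub>L (a o\<^sub>L hadj u)) = a o\<^sub>L hadj e" if a: "a \<in> N" for a
  proof -
    have ab: "a \<in> bounded_ops" "hadj a \<in> bounded_ops"
      using a N_closure by auto
    have "hadj (e o\<^sub>L hadj a) = hadj ((u o\<^sub>L (hadj a o\<^sub>L hadj u)) o\<^sub>L e)"
      using ea a N_closure by simp
    then show ?thesis
      using ab eb mem by (simp add: hadj_compose hadj_hadj bounded_ops_closure compose_assoc)
  qed
  define z where "z = hadj e o\<^sub>L e"
  have zN: "z \<in> N" and zb: "z \<in> bounded_ops" and hz: "hadj z = z"
    using eN eb N_closure by (auto simp: z_def hadj_compose hadj_hadj)
  have za: "a o\<^sub>L z = z o\<^sub>L a" if a: "a \<in> N" for a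
    using ea [OF a] ea' [OF a] by (simp add: z_def compose_assoc) (simp flip: compose_assoc)
  \<comment> \<open>The radius 1/4 originates here: \<open>1 - e* e = (1 - e)* + e* (1 - e)\<close>
    has two terms of norm at most 1/4. Distance 1/2 for \<open>z\<close> in turn bounds that of its
    inverse by 1, the limit for \<open>sqrt_op\<close>.\<close>
  have z_near: "norm (id_blinfun - z) \<le> 1/2"
  proof -
    have "id_blinfun - z = hadj (id_blinfun - e) + (hadj e o\<^sub>L (id_blinfun - e))"
      using eb by (simp add: z_def hadj_diff bounded_ops_closure compose_simps)
    moreover have "norm (hadj (id_blinfun - e)) \<le> 1/4"
      using e_near eb norm_hadj [of "id_blinfun - e"] by (simp add: bounded_ops_closure)
    moreover have "norm (hadj e o\<^sub>L (id_blinfun - e)) \<le> 1 * (1/4)"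
      using e_near norm_e norm_hadj [OF eb(1)]
      by (intro order_trans [OF norm_blinfun_compose] mult_mono) auto
    ultimately show ?thesis
      using norm_triangle_ineq [of "hadj (id_blinfun - e)" "hadj e o\<^sub>L (id_blinfun - e)"] by simp
  qed
  obtain r where r: "z o\<^sub>L r = id_blinfun" "r o\<^sub>L z = id_blinfun"
    and "norm (id_blinfun - r) * (1 - norm (id_blinfun - z)) \<le> norm (id_blinfun - z)"
    using inverse_near_id [of z] z_near by auto
  then have "norm (id_blinfun - r) * (1/2) \<le> 1/2"
    using z_near mult_left_mono [of "1/2" "1 - norm (id_blinfun - z)" "norm (id_blinfun - r)"] by linarith
  then have r_near: "norm (id_blinfun - r) \<le> 1"
    by simp
  note r_comm = commute_inverse [OF r]
  have rb: "r \<in> bounded_ops"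
    using zb r_comm unfolding bounded_ops_iff_commute by blast
  have rN: "r \<in> N"
    using r_comm by (intro von_neumann_algebra_memI [OF N zN rb]) blast
  have "hadj (z o\<^sub>L r) = hadj id_blinfun"
    by (simp add: r)
  then have "hadj r o\<^sub>L z = id_blinfun"
    using zb rb hz by (simp add: hadj_compose)
  then have "(hadj r o\<^sub>L z) o\<^sub>L r = r"
    by simp
  then have hr: "hadj r = r"
    by (simp add: compose_assoc r)
  define f where "f = sqrt_op r"
  have fN: "f \<in> N" and ff: "f o\<^sub>L f = r" and hf: "hadj f = f"
    unfolding f_def using sqrt_op_vna [OF N rN r_near] sqrt_op_square [OF r_near]
      hadj_sqrt_op [OF r_near rb hr] by auto
  have f_comm: "a o\<^sub>L f = f o\<^sub>L a" if "a \<in> N" for a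
    unfolding f_def using sqrt_op_commute [OF r_near r_comm [OF za [OF that]]] .
  have fb: "f \<in> bounded_ops"
    by (rule N_closure(7) [OF fN])
  define v where "v = e o\<^sub>L f"
  have hv: "hadj v = f o\<^sub>L hadj e"
    using eb fb by (simp add: v_def hadj_compose hf)
  have "v \<in> unitaries N"
  proof -
    have "hadj v o\<^sub>L v = (f o\<^sub>L z) o\<^sub>L f"
      unfolding hv by (simp add: v_def z_def compose_assoc)
    also have "\<dots> = z o\<^sub>L (f o\<^sub>L f)"
      by (simp add: compose_assoc flip: f_comm [OF zN])
    finally have 1: "hadj v o\<^sub>L v = id_blinfun"
      by (simp add: ff r)
    \<comment> \<open>So far \<open>v\<close> is only an isometry. The right inverse of
      \<open>e\<close>, inserted at the end as \<open>e o\<^sub>L g\<close>, brings \<open>z\<close>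
      next to \<open>f o\<^sub>L f = r\<close>, its inverse.\<close>
    obtain g where g: "e o\<^sub>L g = id_blinfun"
      using inverse_near_id [of e] e_near by force
    have "v o\<^sub>L hadj v = e o\<^sub>L ((f o\<^sub>L f) o\<^sub>L (hadj e o\<^sub>L (e o\<^sub>L g)))"
      unfolding hv by (simp add: v_def g compose_assoc)
    also have "\<dots> = e o\<^sub>L ((r o\<^sub>L z) o\<^sub>L g)"
      by (simp add: ff z_def compose_assoc)
    finally have "v o\<^sub>L hadj v = id_blinfun"
      by (simp add: r g)
    moreover have "v \<in> N"
      unfolding v_def by (intro N_closure eN fN)
    ultimately show ?thesis
      using 1 by (simp add: unitaries_def)
  qed
  define w where "w = hadj v o\<^sub>L u"
  have wNE: "w \<in> NE"
    unfolding w_def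
    by (rule normalizer_mult [OF normalizer_hadj [OF unitaries_N_normalizer [OF \<open>v \<in> unitaries N\<close>]] u])
  have "w o\<^sub>L a = a o\<^sub>L w" if a: "a \<in> N" for a
  proof -
    have "w o\<^sub>L a = f o\<^sub>L ((hadj e o\<^sub>L (u o\<^sub>L (a o\<^sub>L hadj u))) o\<^sub>L u)"
      by (simp add: w_def hv compose_assoc unitariesD [OF uM])
    also have "\<dots> = (f o\<^sub>L a) o\<^sub>L (hadj e o\<^sub>L u)"
      by (simp add: ea' [OF a] compose_assoc)
    also have "\<dots> = a o\<^sub>L w"
      by (simp add: w_def hv compose_assoc flip: f_comm [OF a])
    finally show ?thesis .
  qed
  moreover have "w \<in> bounded_ops"
    using unitary_mem(3) [OF normalizerD(1) [OF wNE]] .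
  ultimately have "w \<in> commutant N"
    by (simp add: commutant_def)
  moreover have "u = v o\<^sub>L w"
    by (simp add: w_def unitary_cancel [OF \<open>v \<in> unitaries N\<close>])
  ultimately show ?thesis
    unfolding H_exp_alt using \<open>v \<in> unitaries N\<close> wNE by blast
qed

text \<open>The substitution \<open>y = v x v*\<close> is a bijection of \<open>M\<close> that
  carries equality of the two maps at \<open>y\<close> to the normalizer identity for
  \<open>w = u* v\<close> at \<open>x\<close>.\<close>

lemma conj_map_eq_iff:
  assumes u: "u \<in> unitaries M" and v: "v \<in> unitaries M"
  shows "conj_map M E u = conj_map M E v \<longleftrightarrow> hadj u o\<^sub>L v \<in> NE"
proof -
  define w where "w = hadj u o\<^sub>L v"
  note um = unitary_mem [OF u] and vm = unitary_mem [OF v]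
  note uc = unitary_cancel [OF u] and vc = unitary_cancel [OF v]
  have w: "w \<in> unitaries M"
    unfolding w_def by (intro unitaries_closure [OF M] u v)
  have hw: "hadj w = hadj v o\<^sub>L u"
    using um vm by (simp add: w_def hadj_compose)
  have conj_M: "a o\<^sub>L (x o\<^sub>L hadj a) \<in> M" "hadj a o\<^sub>L (x o\<^sub>L a) \<in> M"
    if "a \<in> unitaries M" "x \<in> M" for a x
    using that unitary_mem [OF that(1)] by (intro M_closure; simp)+
  have "conj_map M E u = conj_map M E v \<longleftrightarrow>
      (\<forall>y\<in>M. u o\<^sub>L (E (hadj u o\<^sub>L (y o\<^sub>L u)) o\<^sub>L hadj u) = v o\<^sub>L (E (hadj v o\<^sub>L (y o\<^sub>L v)) o\<^sub>L hadj v))"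
    unfolding conj_map_def fun_eq_iff restrict_def compose_assoc by metis
  also have "\<dots> \<longleftrightarrow> (\<forall>x\<in>M. E (w o\<^sub>L (x o\<^sub>L hadj w)) = w o\<^sub>L (E x o\<^sub>L hadj w))"
  proof
    assume *: "\<forall>y\<in>M. u o\<^sub>L (E (hadj u o\<^sub>L (y o\<^sub>L u)) o\<^sub>L hadj u) = v o\<^sub>L (E (hadj v o\<^sub>L (y o\<^sub>L v)) o\<^sub>L hadj v)"
    show "\<forall>x\<in>M. E (w o\<^sub>L (x o\<^sub>L hadj w)) = w o\<^sub>L (E x o\<^sub>L hadj w)"
    proof
      fix x assume "x \<in> M"
      define y where "y = v o\<^sub>L (x o\<^sub>L hadj v)"
      have "y \<in> M"
        unfolding y_def by (rule conj_M [OF v \<open>x \<in> M\<close>])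
      have x: "hadj v o\<^sub>L (y o\<^sub>L v) = x"
        by (simp add: y_def compose_assoc vc unitariesD [OF v])
      have wx: "w o\<^sub>L (x o\<^sub>L hadj w) = hadj u o\<^sub>L (y o\<^sub>L u)"
        unfolding hw by (simp add: y_def w_def compose_assoc)
      have "u o\<^sub>L (E (hadj u o\<^sub>L (y o\<^sub>L u)) o\<^sub>L hadj u) = v o\<^sub>L (E x o\<^sub>L hadj v)"
        using * \<open>y \<in> M\<close> x by simp
      then have "hadj u o\<^sub>L ((u o\<^sub>L (E (hadj u o\<^sub>L (y o\<^sub>L u)) o\<^sub>L hadj u)) o\<^sub>L u) =
          hadj u o\<^sub>L ((v o\<^sub>L (E x o\<^sub>L hadj v)) o\<^sub>L u)"
        by simp
      then show "E (w o\<^sub>L (x o\<^sub>L hadj w)) = w o\<^sub>L (E x o\<^sub>L hadj w)"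
        unfolding wx unfolding hw by (simp add: w_def compose_assoc uc unitariesD [OF u])
    qed
  next
    assume *: "\<forall>x\<in>M. E (w o\<^sub>L (x o\<^sub>L hadj w)) = w o\<^sub>L (E x o\<^sub>L hadj w)"
    show "\<forall>y\<in>M. u o\<^sub>L (E (hadj u o\<^sub>L (y o\<^sub>L u)) o\<^sub>L hadj u) = v o\<^sub>L (E (hadj v o\<^sub>L (y o\<^sub>L v)) o\<^sub>L hadj v)"
    proof
      fix y assume "y \<in> M"
      define x where "x = hadj v o\<^sub>L (y o\<^sub>L v)"
      have "x \<in> M"
        unfolding x_def by (rule conj_M [OF v \<open>y \<in> M\<close>])
      have "w o\<^sub>L (x o\<^sub>L hadj w) = hadj u o\<^sub>L (y o\<^sub>L u)"
        unfolding hw by (simp add: x_def w_def compose_assoc vc)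
      then have "E (hadj u o\<^sub>L (y o\<^sub>L u)) = w o\<^sub>L (E x o\<^sub>L hadj w)"
        using * \<open>x \<in> M\<close> by metis
      then show "u o\<^sub>L (E (hadj u o\<^sub>L (y o\<^sub>L u)) o\<^sub>L hadj u) = v o\<^sub>L (E (hadj v o\<^sub>L (y o\<^sub>L v)) o\<^sub>L hadj v)"
        unfolding hw by (simp add: w_def x_def compose_assoc uc unitariesD [OF u])
    qed
  qed
  also have "\<dots> \<longleftrightarrow> w \<in> NE"
    using w normalizerD(2) normalizerI by blast
  finally show ?thesis
    by (simp add: w_def)
qed

lemma bi_invariant_quotient_unitary_group:
  "bi_invariant_quotient U NE HE (conj_map M E) (1/4)"
proof (intro bi_invariant_quotient.intro group_unitary_group [OF M] bi_invariant_quotient_axioms.intro)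
  show "connected (carrier U)"
    by (simp add: connected_unitaries [OF M])
  show "dist (z \<otimes>\<^bsub>U\<^esub> x) (z \<otimes>\<^bsub>U\<^esub> y) = dist x y" "dist (x \<otimes>\<^bsub>U\<^esub> z) (y \<otimes>\<^bsub>U\<^esub> z) = dist x y"
    if "x \<in> carrier U" "y \<in> carrier U" "z \<in> carrier U" for x y z
    using norm_unitary_compose [OF M, of z "x - y"] that by (simp_all add: dist_norm compose_simps)
  show "conj_map M E x = conj_map M E y \<longleftrightarrow> inv\<^bsub>U\<^esub> x \<otimes>\<^bsub>U\<^esub> y \<in> NE"
    if "x \<in> carrier U" "y \<in> carrier U" for x y
    using that by (simp add: conj_map_eq_iff inv_unitary_group [OF M])
  show "x \<in> HE" if "x \<in> NE" "dist x \<one>\<^bsub>U\<^esub> < 1/4" for x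
    using that normalizer_near_id by (simp add: dist_norm)
qed (simp_all add: subgroup_normalizer normal_H_exp)

end

theorem theorem2p3:
  fixes M N :: "('h::complex_hilbert_space \<Rightarrow>\<^sub>L 'h) set"
    and E :: "('h \<Rightarrow>\<^sub>L 'h) \<Rightarrow> ('h \<Rightarrow>\<^sub>L 'h)"
  assumes "von_neumann_algebra M" and "von_neumann_algebra N" and "N \<subseteq> M"
    and "conditional_expectation M N E" and "faithful_map M E" and "normal_map M N E"
  shows "\<exists>\<Phi>. (\<forall>u\<in>unitaries M. \<Phi> (u <#\<^bsub>unitary_group M\<^esub> H_exp M N E) = conj_map M E u) \<and>
    covering_map (X_space M N E) (orbit_space M E) \<Phi> \<and>
    (\<forall>u\<in>unitaries M. \<forall>w\<in>normalizer_exp M E.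
       weyl_act M N E (w <#\<^bsub>unitary_group M\<^esub> H_exp M N E) (u <#\<^bsub>unitary_group M\<^esub> H_exp M N E)
         = (u o\<^sub>L w) <#\<^bsub>unitary_group M\<^esub> H_exp M N E) \<and>
    (\<lambda>C\<in>carrier (weyl_group M N E). weyl_act M N E (inv\<^bsub>weyl_group M N E\<^esub> C))
      \<in> iso (weyl_group M N E) (deck_group (X_space M N E) \<Phi>)"
proof -
  interpret cond_exp M N E
    using assms by unfold_locales
  interpret Q: bi_invariant_quotient U NE HE "conj_map M E" "1/4"
    by (rule bi_invariant_quotient_unitary_group)
  have X: "X_space M N E = Q.X" and Y: "orbit_space M E = Q.Y"
    by (simp_all add: X_space_def orbit_space_def)
  have act: "weyl_act M N E = Q.act"
    unfolding weyl_act_def Q.act_def X ..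
  have W: "weyl_group M N E = Q.W"
    by (simp add: weyl_group_def)
  show ?thesis
    unfolding X Y act W
  proof (intro exI conjI ballI)
    show "Q.\<Phi> (u <#\<^bsub>U\<^esub> HE) = conj_map M E u" if "u \<in> unitaries M" for u
      using that by (simp add: Q.\<Phi>_coset)
    show "covering_map Q.X Q.Y Q.\<Phi>"
      by (rule Q.covering_map_\<Phi>)
    show "Q.act (w <#\<^bsub>U\<^esub> HE) (u <#\<^bsub>U\<^esub> HE) = (u o\<^sub>L w) <#\<^bsub>U\<^esub> HE"
      if "u \<in> unitaries M" "w \<in> NE" for u w
      using Q.act_coset [of u w] that by simp
    show "(\<lambda>C\<in>carrier Q.W. Q.act (inv\<^bsub>Q.W\<^esub> C)) \<in> iso Q.W (deck_group Q.X Q.\<Phi>)"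
      by (rule Q.act_iso)
  qed
qed

end
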